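(* Let $0<q,\mu,y<1$, let $s\ge 1$ and let $d_1,\ldots,d_s\in\mathbb{Z}_{\ge 0}$ with $d_1\ge 1$, $d_s\ge 1$. For every integer $r\le 0$ and every $n\in\mathbb{Z}_{\ge0}$, $$P_{\rm III}(r,n)=P(n),\qquad \rho_{\rm III}(r)=\rho,\qquad J_{\rm III}(r)_\pm=J_\pm .$$
   Context: Notation: $(z)_m=\prod_{j=0}^{m-1}(1-zq^j)$ for $m\in\mathbb{Z}_{\ge0}\cup\{\infty\}$; $\binom{m}{k}_q=\frac{(q)_m}{(q)_k(q)_{m-k}}$ for $0\le k\le m$ and $0$ otherwise; $g_m=\frac{(\mu)_m}{(q)_m}$. $q$-bosons: $F=\bigoplus_{m\ge0}\mathbb{C}|m\rangle$ with operators $\mathbf b|m\rangle=|m+1\rangle$, $\mathbf c|m\rangle=(1-q^m)|m-1\rangle$, $\mathbf k|m\rangle=q^m|m\rangle$ (with $|-1\rangle=0$). They satisfy $\mathbf k\mathbf b=q\mathbf b\mathbf k$, $\mathbf k\mathbf c=q^{-1}\mathbf c\mathbf k$, $\mathbf b\mathbf c=1-\mathbf k$, $\mathbf c\mathbf b=1-q\mathbf k$. The algebra $\mathcal B$ they generate has basis $\mathbf b^{\max(t,0)}\mathbf k^{u}\mathbf c^{\max(-t,0)}$ ($u\in\mathbb{Z}_{\ge0}$, $t\in\mathbb{Z}$). For $Q\in\mathcal B$, $Q'$ denotes its projection onto the span of $\{\mathbf k^u: u\ge1\}$, and $\mathrm{Tr}(\mathbf k^u)=(1-q^u)^{-1}$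 for $u\ge 1$. Matrix product operators: with $\frac{(\mu\mathbf b)_\infty}{(\mathbf b)_\infty}=\sum_{j\ge0}g_j\mathbf b^j$, $$X_{a,n}=\frac{(\mu)_{a+n}}{(q)_a(q)_n}\frac{(\mu\mathbf b)_\infty}{(\mathbf b)_\infty}\mathbf k^n\mathbf c^a,\qquad A_a=\sum_{n\ge0}X_{a,n}y^n\qquad(a,n\in\mathbb{Z}_{\ge0}).$$ For a product $Q$ of such operators, $\mathrm{Tr}(Q)'$ means $\mathrm{Tr}(Q')$ computed termwise in the expansion in powers of $y$ coming from the $A_a$'s (for each power of $y$ only finitely many terms have equally many $\mathbf b$'s and $\mathbf c$'s, and these give a polynomial in $\mathbf k$). Conditional probability (of finding $n$ second class particles at site $r$, given $d_i$ first class particles at site $i$ for $1\le i\le s$ and none elsewhere; a site $r\le0$ is understood as $r+L$ on the ring of length $L$), for $r\le 0$: $$P_{\rm III}(r,n)=\lim_{L\to\infty}\frac{y^n\,\mathrm{Tr}(X_{0,n}A_0^{|r|}A_{d_1}\cdots A_{d_s}A_0^{L-|r|-s-1})'}{\mathrm{Tr}(A_{d_1}\cdots A_{d_s}A_0^{L-s})'}.$$ Local density and currents: $\rho_{\rm III}(r)=\sum_{n\ge0}nP_{\rm III}(r,n)$ and $J_{\rm III}(r)_\pm=\sum_{n\ge l\ge1}l\,w_\pm((0,l)|(0,n))P_{\rm III}(r,n)$, where $$w_+((0,l)|(0,n))=\frac{\mu^{l-1}(q)_{l-1}}{(\mu q^{n-l})_l}\binom{n}{l}_q,\qquad w_-((0,l)|(0,n))=\frac{(q)_{l-1}}{(\mu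 q^{n-l})_l}\binom{n}{l}_q.$$ Defect-free values: $P(n)=y^n\frac{(\mu)_n}{(q)_n}\frac{(y)_\infty}{(\mu y)_\infty}$, $\rho=\sum_{i\ge0}\frac{(1-\mu)yq^i}{(1-yq^i)(1-\mu yq^i)}$, $J_+=\mu^{-1}h(\mu y)$, $J_-=h(y)$, with $h(\zeta)=\sum_{i\ge0}\frac{\zeta q^i}{(1-\zeta q^i)^2}$. *)

theory Defs
  imports "HOL-Analysis.Analysis" "HOL-Computational_Algebra.Polynomial"
begin

definition qpoch :: "real \<Rightarrow> real \<Rightarrow> nat \<Rightarrow> real" where
  "qpoch q z m = (\<Prod>j<m. 1 - z * q ^ j)"

definition qpoch_inf :: "real \<Rightarrow> real \<Rightarrow> real" where
  "qpoch_inf q z = (\<Prod>j. 1 - z * q ^ j)"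

definition qbinom :: "real \<Rightarrow> nat \<Rightarrow> nat \<Rightarrow> real" where
  "qbinom q m k = (if k \<le> m then qpoch q q m / (qpoch q q k * qpoch q q (m - k)) else 0)"

definition g :: "real \<Rightarrow> real \<Rightarrow> nat \<Rightarrow> real" where
  "g q \<mu> m = qpoch q \<mu> m / qpoch q q m"

text \<open>
  The Fock space, the direct sum of the lines spanned by the vectors |m>, is represented by the
  underlying vector space of the type of complex polynomials, with |m> the monomial of degree m.
  The ring structure of polynomials is not used.
\<close>

type_synonym fock = "complex poly"

definition ket :: "nat \<Rightarrow> fock" where
  "ket m = monom 1 m"

definition lin_ext :: "(nat \<Rightarrow> fock) \<Rightarrow> fock \<Rightarrow> fock" where
  "lin_ext f v = (\<Sum>m\<le>degree v. smult (coeff v m) (f m))"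

definition qb_b :: "fock \<Rightarrow> fock" where
  "qb_b = lin_ext (\<lambda>m. ket (m + 1))"

definition qb_c :: "real \<Rightarrow> fock \<Rightarrow> fock" where
  "qb_c q = lin_ext (\<lambda>m. if m = 0 then 0 else smult (of_real (1 - q ^ m)) (ket (m - 1)))"

definition qb_k :: "real \<Rightarrow> fock \<Rightarrow> fock" where
  "qb_k q = lin_ext (\<lambda>m. smult (of_real (q ^ m)) (ket m))"

definition qb_basis :: "real \<Rightarrow> int \<times> nat \<Rightarrow> fock \<Rightarrow> fock" where
  "qb_basis q = (\<lambda>(t, u). (qb_b ^^ nat t) \<circ> (qb_k q ^^ u) \<circ> (qb_c q ^^ nat (- t)))"

text \<open>
  Coordinates of an element of the q-boson algebra, the span of the qb_basis q (t, u); these are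
  linearly independent for 0 < q < 1.
\<close>

definition qb_coeff :: "real \<Rightarrow> (fock \<Rightarrow> fock) \<Rightarrow> int \<times> nat \<Rightarrow> complex" where
  "qb_coeff q Q = (THE f. finite {x. f x \<noteq> 0} \<and>
     Q = (\<lambda>v. \<Sum>x | f x \<noteq> 0. smult (f x) (qb_basis q x v)))"

definition qb_proj :: "real \<Rightarrow> (fock \<Rightarrow> fock) \<Rightarrow> fock \<Rightarrow> fock" where
  "qb_proj q Q = (\<lambda>v. \<Sum>u | 1 \<le> u \<and> qb_coeff q Q (0, u) \<noteq> 0.
     smult (qb_coeff q Q (0, u)) ((qb_k q ^^ u) v))"

text \<open>The linear functional with Tr(k^u) = 1/(1 - q^u), meant for the span of the k^u with u >= 1.\<close>

definition qb_Tr :: "real \<Rightarrow> (fock \<Rightarrow> fock) \<Rightarrow> complex" where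
  "qb_Tr q Q = (\<Sum>u | 1 \<le> u \<and> qb_coeff q Q (0, u) \<noteq> 0.
     qb_coeff q Q (0, u) * of_real (1 / (1 - q ^ u)))"

text \<open>
  The operator X(a,n) is the formal series, over j, of
    x_coeff a n j * b^j k^n c^a,
  obtained by expanding (mu b)_inf / (b)_inf as the series of the g_j b^j. A product
  X(a_1,n_1) ... X(a_m,n_m) is encoded by the list of the pairs (a_i,n_i), and the terms of its
  expansion are indexed by the lists of the exponents j_1, ..., j_m.
\<close>

definition x_coeff :: "real \<Rightarrow> real \<Rightarrow> nat \<Rightarrow> nat \<times> nat \<Rightarrow> real" where
  "x_coeff q \<mu> j = (\<lambda>(a, n). qpoch q \<mu> (a + n) / (qpoch q q a * qpoch q q n) * g q \<mu> j)"

definition x_term :: "real \<Rightarrow> nat \<Rightarrow> nat \<times> nat \<Rightarrow> fock \<Rightarrow> fock" where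
  "x_term q j = (\<lambda>(a, n). (qb_b ^^ j) \<circ> (qb_k q ^^ n) \<circ> (qb_c q ^^ a))"

text \<open>
  The terms of the product with equally many b's and c's. There are finitely many of them, and the
  other terms have no component along the powers of k.
\<close>

definition X_balanced :: "real \<Rightarrow> real \<Rightarrow> (nat \<times> nat) list \<Rightarrow> fock \<Rightarrow> fock" where
  "X_balanced q \<mu> xs = (\<lambda>v.
     \<Sum>js | length js = length xs \<and> sum_list js = sum_list (map fst xs).
       smult (of_real (prod_list (map2 (x_coeff q \<mu>) js xs)))
         (foldr (\<circ>) (map2 (x_term q) js xs) id v))"

text \<open>
  For Q the product of the X(a,n), (a,n) in xs, followed by the product of the A(a), a in ds:
  the balanced part of the coefficient of y^N in Q, the N-th term of the series Tr(Q)', and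
  its sum. Only the factors A(a) contribute powers of y.
\<close>

definition XA_balanced ::
  "real \<Rightarrow> real \<Rightarrow> (nat \<times> nat) list \<Rightarrow> nat list \<Rightarrow> nat \<Rightarrow> fock \<Rightarrow> fock" where
  "XA_balanced q \<mu> xs ds N = (\<lambda>v.
     \<Sum>ns | length ns = length ds \<and> sum_list ns = N. X_balanced q \<mu> (xs @ zip ds ns) v)"

definition Tr_series ::
  "real \<Rightarrow> real \<Rightarrow> real \<Rightarrow> (nat \<times> nat) list \<Rightarrow> nat list \<Rightarrow> nat \<Rightarrow> complex" where
  "Tr_series q \<mu> y xs ds N = of_real (y ^ N) * qb_Tr q (qb_proj q (XA_balanced q \<mu> xs ds N))"

definition Tr' ::
  "real \<Rightarrow> real \<Rightarrow> real \<Rightarrow> (nat \<times> nat) list \<Rightarrow> nat list \<Rightarrow> complex" where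
  "Tr' q \<mu> y xs ds = (\<Sum>N. Tr_series q \<mu> y xs ds N)"

text \<open>
  Indices of the factors A in the numerator and in the denominator of the conditional probability
  on the ring of length L; these are only meaningful when L > |r| + s, with s the length of ds.
\<close>

definition num_sites :: "nat list \<Rightarrow> int \<Rightarrow> nat \<Rightarrow> nat list" where
  "num_sites ds r L =
     replicate (nat \<bar>r\<bar>) 0 @ ds @ replicate (L - nat \<bar>r\<bar> - length ds - 1) 0"

definition den_sites :: "nat list \<Rightarrow> nat \<Rightarrow> nat list" where
  "den_sites ds L = ds @ replicate (L - length ds) 0"

definition P_ring ::
  "real \<Rightarrow> real \<Rightarrow> real \<Rightarrow> nat list \<Rightarrow> int \<Rightarrow> nat \<Rightarrow> nat \<Rightarrow> complex" where
  "P_ring q \<mu> y ds r n L =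
     of_real (y ^ n) * Tr' q \<mu> y [(0, n)] (num_sites ds r L) / Tr' q \<mu> y [] (den_sites ds L)"

definition P_III :: "real \<Rightarrow> real \<Rightarrow> real \<Rightarrow> nat list \<Rightarrow> int \<Rightarrow> nat \<Rightarrow> complex" where
  "P_III q \<mu> y ds r n = lim (\<lambda>L. P_ring q \<mu> y ds r n L)"

definition w_plus :: "real \<Rightarrow> real \<Rightarrow> nat \<Rightarrow> nat \<Rightarrow> real" where
  "w_plus q \<mu> l n =
     \<mu> ^ (l - 1) * qpoch q q (l - 1) / qpoch q (\<mu> * q ^ (n - l)) l * qbinom q n l"

definition w_minus :: "real \<Rightarrow> real \<Rightarrow> nat \<Rightarrow> nat \<Rightarrow> real" where
  "w_minus q \<mu> l n = qpoch q q (l - 1) / qpoch q (\<mu> * q ^ (n - l)) l * qbinom q n l"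

definition rho_term :: "real \<Rightarrow> real \<Rightarrow> real \<Rightarrow> nat list \<Rightarrow> int \<Rightarrow> nat \<Rightarrow> complex" where
  "rho_term q \<mu> y ds r n = of_nat n * P_III q \<mu> y ds r n"

definition rho_III :: "real \<Rightarrow> real \<Rightarrow> real \<Rightarrow> nat list \<Rightarrow> int \<Rightarrow> complex" where
  "rho_III q \<mu> y ds r = (\<Sum>n. rho_term q \<mu> y ds r n)"

definition J_dom :: "(nat \<times> nat) set" where
  "J_dom = {(n, l). n \<ge> l \<and> l \<ge> 1}"

text \<open>The rate function w is w_plus q mu or w_minus q mu.\<close>

definition J_term ::
  "(nat \<Rightarrow> nat \<Rightarrow> real) \<Rightarrow> real \<Rightarrow> real \<Rightarrow> real \<Rightarrow> nat list \<Rightarrow> int \<Rightarrow> nat \<times> nat \<Rightarrow> complex"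
  where
  "J_term w q \<mu> y ds r = (\<lambda>(n, l). of_nat l * of_real (w l n) * P_III q \<mu> y ds r n)"

definition J_III_plus :: "real \<Rightarrow> real \<Rightarrow> real \<Rightarrow> nat list \<Rightarrow> int \<Rightarrow> complex" where
  "J_III_plus q \<mu> y ds r = infsum (J_term (w_plus q \<mu>) q \<mu> y ds r) J_dom"

definition J_III_minus :: "real \<Rightarrow> real \<Rightarrow> real \<Rightarrow> nat list \<Rightarrow> int \<Rightarrow> complex" where
  "J_III_minus q \<mu> y ds r = infsum (J_term (w_minus q \<mu>) q \<mu> y ds r) J_dom"

definition P_free :: "real \<Rightarrow> real \<Rightarrow> real \<Rightarrow> nat \<Rightarrow> real" where
  "P_free q \<mu> y n =
     y ^ n * (qpoch q \<mu> n / qpoch q q n) * (qpoch_inf q y / qpoch_inf q (\<mu> * y))"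

definition rho_free :: "real \<Rightarrow> real \<Rightarrow> real \<Rightarrow> real" where
  "rho_free q \<mu> y =
     (\<Sum>i. (1 - \<mu>) * y * q ^ i / ((1 - y * q ^ i) * (1 - \<mu> * y * q ^ i)))"

definition h :: "real \<Rightarrow> real \<Rightarrow> real" where
  "h q \<zeta> = (\<Sum>i. \<zeta> * q ^ i / (1 - \<zeta> * q ^ i)\<^sup>2)"

definition J_free_plus :: "real \<Rightarrow> real \<Rightarrow> real \<Rightarrow> real" where
  "J_free_plus q \<mu> y = h q (\<mu> * y) / \<mu>"

definition J_free_minus :: "real \<Rightarrow> real \<Rightarrow> real" where
  "J_free_minus q y = h q y"

end

theory Submission
  imports Defs
begin

text \<open>
  Let K(z) be the sum of the g_j z^j. On the row vectors <l|, the operator A_0 is triangular with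
  diagonal entries K(y q^l), strictly decreasing in l. Hence Tr(... A_0^R)' is dominated by the
  vacuum expectation <0| ... A_0^R |0>, of order K(y)^R; the rest is of smaller exponential order.
  Since <0| is a left eigenvector of X_{0,n} and A_0, with eigenvalues g_n and K(y), the vacuum
  expectations in numerator and denominator of P_III have ratio g_n K(y)^{|r|} up to the number of
  factors A_0 on the right, whence P_III(r, n) = y^n g_n / K(y). By the q-binomial theorem
  K(y) = (mu y)_inf / (y)_inf, so this is P(n); density and currents are then sums over n.
\<close>

subsection \<open>Diagonal operators on the Fock space\<close>

text \<open>Since 1/(1 - q^u) is the sum of the q^(um), the functional on p(k) is the sum over m of
  p(q^m) - p(0): a trace over the Fock space without the divergent constant term. The term m = 0 is
  the vacuum expectation. For the rest, bounds on matrix elements are not enough: for each word the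
  values p(q^m) lie in [0, 1], but factors (k q^s)^n with s < 0 and unbounded n give p large
  coefficients. So the sum is split after D terms, D being the number of c's: the first ones are
  bounded as matrix elements, the others through the coefficients, with k weighted by q^D. Both
  estimates gain at least a factor q for every k in the final block of A_0's, which replaces K(y) by
  K(y q) there. The price is the sum over the positions of the b's. A balanced word has exactly D of
  them, whatever R is, so this sum is at most t^(-D) K(t)^k for k factors and any t in (0, 1). As
  K(t) tends to 1 for t tending to 0, some t satisfies K(t) K(y q) < K(y).\<close>

lemma coeff_lin_ext: "coeff (lin_ext f v) i = (\<Sum>m\<le>degree v. coeff v m * coeff (f m) i)"
  by (simp add: lin_ext_def coeff_sum)

lemma coeff_sum_ket:
  fixes v :: fock
  shows "(\<Sum>m\<le>degree v. coeff v m * (if P m \<and> m = j then c m else 0)) =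
    (if P j then c j * coeff v j else 0)"
proof -
  have "(\<Sum>m\<le>degree v. coeff v m * (if P m \<and> m = j then c m else 0)) =
    (\<Sum>m\<le>degree v. if m = j then (if P j then c j * coeff v j else 0) else 0)"
    by (rule sum.cong) auto
  also have "\<dots> = (if P j then c j * coeff v j else 0)"
    by (auto simp: sum.delta coeff_eq_0)
  finally show ?thesis .
qed

lemma coeff_qb_b: "coeff (qb_b v) i = (if i = 0 then 0 else coeff v (i - 1))"
proof -
  have "coeff (qb_b v) i = (\<Sum>m\<le>degree v. coeff v m * (if i \<noteq> 0 \<and> m = i - 1 then 1 else 0))"
    unfolding qb_b_def coeff_lin_ext by (rule sum.cong) (auto simp: ket_def)
  then show ?thesis using coeff_sum_ket[of v "\<lambda>_. i \<noteq> 0" "i - 1" "\<lambda>_. 1"] by simp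
qed

lemma coeff_qb_k: "coeff (qb_k q v) i = of_real (q ^ i) * coeff v i"
proof -
  have "coeff (qb_k q v) i = (\<Sum>m\<le>degree v. coeff v m * (if True \<and> m = i then of_real (q ^ m) else 0))"
    unfolding qb_k_def coeff_lin_ext by (rule sum.cong) (auto simp: ket_def)
  then show ?thesis using coeff_sum_ket[of v "\<lambda>_. True" i "\<lambda>m. of_real (q ^ m)"] by simp
qed

lemma coeff_qb_c: "coeff (qb_c q v) i = of_real (1 - q ^ (i + 1)) * coeff v (i + 1)"
proof -
  have "coeff (qb_c q v) i =
    (\<Sum>m\<le>degree v. coeff v m * (if True \<and> m = i + 1 then of_real (1 - q ^ m) else 0))"
    unfolding qb_c_def coeff_lin_ext by (rule sum.cong) (auto simp: ket_def)
  then show ?thesis using coeff_sum_ket[of v "\<lambda>_. True" "i + 1" "\<lambda>m. of_real (1 - q ^ m)"] by simp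
qed

lemma coeff_qb_b_pow: "coeff ((qb_b ^^ j) v) i = (if i < j then 0 else coeff v (i - j))"
  by (induction j arbitrary: i) (auto simp: coeff_qb_b)

lemma coeff_qb_k_pow: "coeff ((qb_k q ^^ n) v) i = of_real ((q ^ i) ^ n) * coeff v i"
  by (induction n) (auto simp: coeff_qb_k)

text \<open>c^a maps |m> to this multiple of |m - a>. For a > m the index i = m contributes 1 - q^0
  = 0, in agreement with |-1> = 0.\<close>

definition lowering :: "real \<Rightarrow> nat \<Rightarrow> nat \<Rightarrow> real" where
  "lowering q a m = (\<Prod>i<a. 1 - q ^ (m - i))"

lemma coeff_qb_c_pow:
  "coeff ((qb_c q ^^ a) v) i = of_real (lowering q a (i + a)) * coeff v (i + a)"
proof (induction a arbitrary: i)
  case (Suc a)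
  have "coeff ((qb_c q ^^ Suc a) v) i =
    of_real (1 - q ^ (i + 1)) * (of_real (lowering q a (i + 1 + a)) * coeff v (i + 1 + a))"
    by (simp add: coeff_qb_c Suc)
  moreover have "lowering q (Suc a) (i + Suc a) = (1 - q ^ (i + 1)) * lowering q a (i + 1 + a)"
    by (simp add: lowering_def)
  ultimately show ?case by simp
qed (simp add: lowering_def)

lemma coeff_x_term:
  "coeff (x_term q j (a, n) v) l = (if l < j then 0 else
     of_real ((q ^ (l - j)) ^ n * lowering q a (l - j + a)) * coeff v (l - j + a))"
  by (simp add: x_term_def coeff_qb_b_pow coeff_qb_k_pow coeff_qb_c_pow)

lemma coeff_qb_basis:
  "coeff (qb_basis q (t, u) v) l = coeff (x_term q (nat t) (nat (- t), u) v) l"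
  by (simp add: qb_basis_def x_term_def)

text \<open>In operator terms Q = p(k). From here on the trace is computed from the real polynomial
  p.\<close>

definition diagonal :: "real \<Rightarrow> real poly \<Rightarrow> (fock \<Rightarrow> fock) \<Rightarrow> bool" where
  "diagonal q p Q \<longleftrightarrow> (\<forall>v m. coeff (Q v) m = of_real (poly p (q ^ m)) * coeff v m)"

lemma coeff_ket: "coeff (ket m) i = (if m = i then 1 else 0)"
  by (simp add: ket_def)

lemma lowering_pos:
  assumes "0 < q" "q < 1" "a \<le> m"
  shows "0 < lowering q a m"
  unfolding lowering_def using assms by (intro prod_pos) (auto simp: power_less_one_iff)

text \<open>Basis elements with different t move |m> to different kets, so one matrix element
  isolates a single t. What remains is a polynomial in k with the infinitely many roots q^i. This
  gives the definite description in \<open>qb_coeff\<close> its meaning.\<close>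

lemma qb_basis_independent:
  assumes q: "0 < q" "q < 1" and fin: "finite S"
    and zero: "\<And>v. (\<Sum>x\<in>S. smult (f x) (qb_basis q x v)) = 0"
    and x: "x \<in> S"
  shows "f x = 0"
proof -
  obtain t u where tu: "x = (t, u)" by (cases x)
  define U where "U = {u. (t, u) \<in> S}"
  have "U \<subseteq> snd ` S" by (force simp: U_def)
  then have finU: "finite U" using fin finite_surj by blast
  define r :: "complex poly" where "r = (\<Sum>u\<in>U. monom (f (t, u)) u)"
  have root: "poly r (of_real (q ^ i)) = 0" for i
  proof -
    \<comment> \<open>c^max(-t,0) takes |m> to a multiple of |i>, where k has eigenvalue q^i, and
      b^max(t,0) takes |i> to |l>. Any other t' misses |l>.\<close>
    define m where "m = i + nat (- t)"
    define l where "l = i + nat t"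
    have "0 = coeff (\<Sum>x\<in>S. smult (f x) (qb_basis q x (ket m))) l" by (simp add: zero)
    also have "\<dots> = (\<Sum>x\<in>S. f x * coeff (qb_basis q x (ket m)) l)" by (simp add: coeff_sum)
    also have "\<dots> = (\<Sum>x\<in>Pair t ` U. f x * coeff (qb_basis q x (ket m)) l)"
    proof (rule sum.mono_neutral_right[OF fin])
      show "Pair t ` U \<subseteq> S" by (auto simp: U_def)
      show "\<forall>x\<in>S - Pair t ` U. f x * coeff (qb_basis q x (ket m)) l = 0"
      proof
        fix x assume "x \<in> S - Pair t ` U"
        then obtain t' u' where x': "x = (t', u')" "t' \<noteq> t"
          by (cases x) (auto simp: U_def)
        then show "f x * coeff (qb_basis q x (ket m)) l = 0"
          by (auto simp: coeff_qb_basis coeff_x_term coeff_ket m_def l_def)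
      qed
    qed
    also have "\<dots> = (\<Sum>u\<in>U. f (t, u) * coeff (qb_basis q (t, u) (ket m)) l)"
      by (subst sum.reindex) (auto intro: inj_onI)
    also have "\<dots> = (\<Sum>u\<in>U. f (t, u) * of_real (q ^ i) ^ u) * of_real (lowering q (nat (- t)) m)"
      by (simp add: coeff_qb_basis coeff_x_term coeff_ket m_def l_def sum_distrib_left sum_distrib_right ac_simps)
    also have "(\<Sum>u\<in>U. f (t, u) * of_real (q ^ i) ^ u) = poly r (of_real (q ^ i))"
      by (simp add: r_def poly_sum poly_monom)
    finally show ?thesis using lowering_pos[OF q, of "nat (- t)" m] by (simp add: m_def)
  qed
  have "inj (\<lambda>i. complex_of_real (q ^ i))"
    using q by (intro injI) (simp only: of_real_eq_iff, metis power_inject_exp' less_irrefl less_numeral_extra(1))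
  then have "infinite (range (\<lambda>i. complex_of_real (q ^ i)))"
    using finite_imageD by blast
  moreover have "range (\<lambda>i. complex_of_real (q ^ i)) \<subseteq> {z. poly r z = 0}" using root by auto
  ultimately have "r = 0" using poly_roots_finite[of r] finite_subset by blast
  moreover have "coeff r u = (\<Sum>u'\<in>U. if u' = u then f (t, u') else 0)" by (simp add: r_def coeff_sum)
  ultimately show ?thesis using x tu finU by (simp add: U_def)
qed

lemma qb_coeff_unique:
  assumes q: "0 < q" "q < 1"
    and f: "finite {x. f x \<noteq> 0}" "Q = (\<lambda>v. \<Sum>x | f x \<noteq> 0. smult (f x) (qb_basis q x v))"
  shows "qb_coeff q Q = f"
  unfolding qb_coeff_def
proof (rule the_equality)
  fix f' assume f': "finite {x. f' x \<noteq> 0} \<and> Q = (\<lambda>v. \<Sum>x | f' x \<noteq> 0. smult (f' x) (qb_basis q x v))"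
  let ?S = "{x. f x \<noteq> 0} \<union> {x. f' x \<noteq> 0}"
  have fin: "finite ?S" using f f' by simp
  have "(\<Sum>x\<in>?S. smult (f' x - f x) (qb_basis q x v)) = 0" for v
  proof -
    have "(\<Sum>x\<in>?S. smult (f' x) (qb_basis q x v)) = Q v"
      using f' by (auto intro!: sum.mono_neutral_right[OF fin])
    moreover have "(\<Sum>x\<in>?S. smult (f x) (qb_basis q x v)) = Q v"
      unfolding f(2) by (auto intro!: sum.mono_neutral_right[OF fin])
    ultimately show ?thesis by (simp add: smult_diff_left sum_subtractf)
  qed
  then have "x \<in> ?S \<Longrightarrow> f' x - f x = 0" for x
    by (rule qb_basis_independent[OF q fin])
  then have "f' x = f x" for x by (cases "x \<in> ?S") auto
  then show "f' = f" by (rule ext)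
qed (use f in auto)

lemma diagonal_qb_coeff:
  assumes q: "0 < q" "q < 1" and diag: "diagonal q p Q"
  shows "qb_coeff q Q = (\<lambda>(t, u). if t = 0 then of_real (coeff p u) else 0)"
proof (rule qb_coeff_unique[OF q])
  let ?f = "\<lambda>(t::int, u). if t = 0 then complex_of_real (coeff p u) else 0"
  have supp: "{x. ?f x \<noteq> 0} = Pair 0 ` {u. coeff p u \<noteq> 0}"
    by (auto split: if_splits)
  have finU: "finite {u. coeff p u \<noteq> 0}"
    by (rule finite_subset[of _ "{..degree p}"]) (auto simp: le_degree)
  show "finite {x. ?f x \<noteq> 0}" unfolding supp using finU by simp
  show "Q = (\<lambda>v. \<Sum>x | ?f x \<noteq> 0. smult (?f x) (qb_basis q x v))"
  proof (rule ext, rule poly_eqI)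
    fix v m
    have "coeff (\<Sum>x | ?f x \<noteq> 0. smult (?f x) (qb_basis q x v)) m =
      (\<Sum>u | coeff p u \<noteq> 0. of_real (coeff p u) * coeff (qb_basis q (0, u) v) m)"
      unfolding supp by (subst sum.reindex) (auto intro: inj_onI simp: coeff_sum)
    also have "\<dots> = (\<Sum>u | coeff p u \<noteq> 0. of_real (coeff p u * (q ^ m) ^ u)) * coeff v m"
      by (simp add: coeff_qb_basis coeff_x_term lowering_def sum_distrib_right mult.assoc)
    also have "(\<Sum>u | coeff p u \<noteq> 0. complex_of_real (coeff p u * (q ^ m) ^ u)) =
      of_real (poly p (q ^ m))"
      unfolding poly_altdef of_real_sum
      by (rule sum.mono_neutral_left) (auto simp: le_degree)
    finally show "coeff (Q v) m = coeff (\<Sum>x | ?f x \<noteq> 0. smult (?f x) (qb_basis q x v)) m"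
      using diag by (simp add: diagonal_def)
  qed
qed

text \<open>Starting at u = 1 carries out the projection Q' as well, which removes exactly the
  constant term.\<close>

definition k_trace :: "real \<Rightarrow> real poly \<Rightarrow> real" where
  "k_trace q p = (\<Sum>u=1..degree p. coeff p u / (1 - q ^ u))"

lemma diagonal_qb_Tr:
  assumes q: "0 < q" "q < 1" and diag: "diagonal q p Q"
  shows "qb_Tr q (qb_proj q Q) = of_real (k_trace q p)"
proof -
  note c = diagonal_qb_coeff[OF q diag]
  define p' where "p' = p - [:coeff p 0:]"
  have p'0: "coeff p' u = (if u = 0 then 0 else coeff p u)" for u
    by (auto simp: p'_def coeff_pCons split: nat.splits)
  have "diagonal q p' (qb_proj q Q)"
    unfolding diagonal_def
  proof (intro allI)
    fix v m
    have "coeff (qb_proj q Q v) m =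
      (\<Sum>u | 1 \<le> u \<and> coeff p u \<noteq> 0. of_real (coeff p u * (q ^ m) ^ u)) * coeff v m"
      by (simp add: qb_proj_def c coeff_sum coeff_qb_k_pow sum_distrib_left sum_distrib_right ac_simps)
    also have "(\<Sum>u | 1 \<le> u \<and> coeff p u \<noteq> 0. complex_of_real (coeff p u * (q ^ m) ^ u)) =
      of_real (poly p' (q ^ m))"
      unfolding poly_altdef of_real_sum
      by (rule sum.mono_neutral_cong_left) (auto simp: p'0 intro!: le_degree)
    finally show "coeff (qb_proj q Q v) m = of_real (poly p' (q ^ m)) * coeff v m" .
  qed
  note c' = diagonal_qb_coeff[OF q this]
  have "qb_Tr q (qb_proj q Q) =
    (\<Sum>u | 1 \<le> u \<and> coeff p u \<noteq> 0. of_real (coeff p u * (1 / (1 - q ^ u))))"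
    unfolding qb_Tr_def c' of_real_mult by (rule sum.cong) (auto simp: p'0)
  also have "\<dots> = (\<Sum>u=1..degree p. of_real (coeff p u * (1 / (1 - q ^ u))))"
    by (rule sum.mono_neutral_left) (auto intro!: le_degree)
  finally show ?thesis by (simp add: k_trace_def)
qed

subsection \<open>Words in the q-bosons as polynomials in k\<close>

definition shift :: "(nat \<times> nat \<times> nat) list \<Rightarrow> int" where
  "shift w = (\<Sum>(j, a, n)\<leftarrow>w. int j - int a)"

lemma shift_simps [simp]: "shift [] = 0" "shift ((j, a, n) # w) = int j - int a + shift w"
  by (simp_all add: shift_def)

text \<open>
  The word w, a list of triples (j, a, n), stands for the product of the b^j k^n c^a. It maps |m>
  to a multiple of |m + shift w>, and path_poly expresses the factor as a polynomial in k = q^m.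
\<close>

fun path_poly :: "real \<Rightarrow> (nat \<times> nat \<times> nat) list \<Rightarrow> real poly" where
  "path_poly q [] = 1"
| "path_poly q ((j, a, n) # w) =
     path_poly q w * monom ((q powi (shift w - int a)) ^ n) n *
     (\<Prod>i<a. [:1, - (q powi (shift w - int i)):])"

lemma poly_path_poly_Cons:
  "poly (path_poly q ((j, a, n) # w)) x =
     poly (path_poly q w) x * (x * q powi (shift w - int a)) ^ n *
     (\<Prod>i<a. 1 - x * q powi (shift w - int i))"
  by (simp add: poly_prod poly_monom power_mult_distrib)

lemma power_int_shift:
  assumes "q \<noteq> (0::real)" "int l = int m + s"
  shows "q ^ m * q powi s = q ^ l"
proof -
  have "q ^ m * q powi s = q powi (int m + s)" using assms(1) by (simp add: power_int_add)
  then show ?thesis using assms(2) by (metis power_int_of_nat)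
qed

text \<open>Where the operator leaves the Fock space, the polynomial has to vanish by itself. Either
  w has already left it, or c^a crosses |0>, and then the factor with i = m + \<open>shift w\<close>
  is 1 - q^0. The exponents are integers because partial words can have negative shift.\<close>

lemma path_poly_eq_0:
  assumes q: "q \<noteq> (0::real)" and l: "int m + shift w - int a < 0"
    and w: "int m + shift w < 0 \<Longrightarrow> poly (path_poly q w) (q ^ m) = 0"
  shows "poly (path_poly q ((j, a, n) # w)) (q ^ m) = 0"
proof (cases "int m + shift w < 0")
  case False
  then obtain i where i: "int i = int m + shift w" by (metis not_less zero_le_imp_eq_int)
  then have "i < a" using l by simp
  moreover have "1 - q ^ m * q powi (shift w - int i) = 0"
    using power_int_shift[OF q, of 0 m "shift w - int i"] i by simp
  ultimately show ?thesis by (auto simp: poly_path_poly_Cons simp del: path_poly.simps)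
qed (simp add: w poly_path_poly_Cons del: path_poly.simps)

lemma poly_path_poly_Cons_nat:
  assumes q: "q \<noteq> (0::real)" and l: "int l = int m + shift w - int a"
  shows "poly (path_poly q ((j, a, n) # w)) (q ^ m) =
    poly (path_poly q w) (q ^ m) * ((q ^ l) ^ n * lowering q a (l + a))"
proof -
  have "q ^ m * q powi (shift w - int a) = q ^ l"
    by (rule power_int_shift[OF q]) (use l in simp)
  moreover have "(\<Prod>i<a. 1 - q ^ m * q powi (shift w - int i)) = lowering q a (l + a)"
    unfolding lowering_def
    by (intro prod.cong refl arg_cong[where f = "\<lambda>x. 1 - x"] power_int_shift[OF q]) (use l in auto)
  ultimately show ?thesis by (simp add: poly_path_poly_Cons del: path_poly.simps)
qed

definition word_op :: "real \<Rightarrow> (nat \<times> nat \<times> nat) list \<Rightarrow> fock \<Rightarrow> fock" where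
  "word_op q w = foldr (\<circ>) (map (\<lambda>(j, x). x_term q j x) w) id"

lemma path_poly_vanishes:
  assumes "q \<noteq> (0::real)" "int m + shift w < 0"
  shows "poly (path_poly q w) (q ^ m) = 0"
  using assms(2)
proof (induction w)
  case (Cons x w)
  obtain j a n where x: "x = (j, a, n)" by (cases x)
  show ?case unfolding x by (rule path_poly_eq_0[OF assms(1)]) (use Cons x in auto)
qed simp

text \<open>The second conjunct covers the positions l that no |m> reaches when the shift is
  positive. Together the two describe every coefficient of the image, which is what the induction
  consumes.\<close>

lemma coeff_word_op:
  assumes q: "q \<noteq> 0"
  shows "(\<forall>m l. int l = int m + shift w \<longrightarrow>
       coeff (word_op q w v) l = of_real (poly (path_poly q w) (q ^ m)) * coeff v m) \<and>
    (\<forall>l. int l < shift w \<longrightarrow> coeff (word_op q w v) l = 0)"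
proof (induction w)
  case (Cons x w)
  obtain j a n where x: "x = (j, a, n)" by (cases x)
  have op: "word_op q (x # w) v = x_term q j (a, n) (word_op q w v)"
    by (simp add: word_op_def x)
  have "coeff (word_op q (x # w) v) l = of_real (poly (path_poly q (x # w)) (q ^ m)) * coeff v m"
    if l: "int l = int m + shift (x # w)" for m l
  proof (cases "l < j")
    case True
    then have "poly (path_poly q (x # w)) (q ^ m) = 0"
      unfolding x by (intro path_poly_eq_0[OF q] path_poly_vanishes[OF q]) (use l x in auto)
    then show ?thesis using True by (simp add: op coeff_x_term)
  next
    case False
    have "poly (path_poly q (x # w)) (q ^ m) =
      poly (path_poly q w) (q ^ m) * ((q ^ (l - j)) ^ n * lowering q a (l - j + a))"
      unfolding x by (rule poly_path_poly_Cons_nat[OF q]) (use l x False in auto)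
    moreover have "coeff (word_op q w v) (l - j + a) = of_real (poly (path_poly q w) (q ^ m)) * coeff v m"
      using Cons l x False by auto
    ultimately show ?thesis using False by (simp add: op coeff_x_term)
  qed
  moreover have "coeff (word_op q (x # w) v) l = 0" if "int l < shift (x # w)" for l
  proof (cases "l < j")
    case False
    then have "int (l - j + a) < shift w" using that x by auto
    then show ?thesis using Cons by (simp add: op coeff_x_term)
  qed (simp add: op coeff_x_term)
  ultimately show ?case by blast
qed (simp add: word_op_def)

lemma diagonal_word_op:
  assumes "q \<noteq> 0" "shift w = 0"
  shows "diagonal q (path_poly q w) (word_op q w)"
  using coeff_word_op[OF assms(1), of w] assms(2) by (simp add: diagonal_def)

lemma diagonal_sum:
  assumes "\<And>i. i \<in> I \<Longrightarrow> diagonal q (p i) (Q i)"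
  shows "diagonal q (\<Sum>i\<in>I. smult (c i) (p i)) (\<lambda>v. \<Sum>i\<in>I. smult (of_real (c i)) (Q i v))"
  using assms by (simp add: diagonal_def coeff_sum poly_sum sum_distrib_right mult.assoc)

definition exps :: "nat \<Rightarrow> nat \<Rightarrow> nat list set" where
  "exps k N = {ns. length ns = k \<and> sum_list ns = N}"

lemma exps_0: "exps 0 N = (if N = 0 then {[]} else {})"
  by (auto simp: exps_def)

lemma exps_Suc: "exps (Suc k) N = (\<Union>n\<le>N. (#) n ` exps k (N - n))"
  by (auto simp: exps_def image_iff length_Suc_conv)

lemma finite_exps [simp]: "finite (exps k N)"
  by (induction k arbitrary: N) (auto simp: exps_0 exps_Suc)

lemma sum_exps_Suc:
  fixes f :: "nat list \<Rightarrow> 'b::comm_monoid_add"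
  shows "(\<Sum>ns\<in>exps (Suc k) N. f ns) = (\<Sum>n\<le>N. \<Sum>ns\<in>exps k (N - n). f (n # ns))"
  unfolding exps_Suc by (subst sum.UNION_disjoint) (auto simp: sum.reindex)

definition path_weight :: "real \<Rightarrow> real \<Rightarrow> nat list \<Rightarrow> (nat \<times> nat) list \<Rightarrow> real" where
  "path_weight q \<mu> js xs = prod_list (map2 (x_coeff q \<mu>) js xs)"

lemma shift_zip:
  assumes "length js = length xs"
  shows "shift (zip js xs) = int (sum_list js) - int (sum_list (map fst xs))"
  using assms by (induction js xs rule: list_induct2) (auto simp: shift_def)

lemma diagonal_X_balanced:
  assumes q: "q \<noteq> 0"
  shows "diagonal q
    (\<Sum>js\<in>exps (length xs) (sum_list (map fst xs)). smult (path_weight q \<mu> js xs) (path_poly q (zip js xs)))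
    (X_balanced q \<mu> xs)"
proof -
  have "X_balanced q \<mu> xs =
    (\<lambda>v. \<Sum>js\<in>exps (length xs) (sum_list (map fst xs)).
      smult (of_real (path_weight q \<mu> js xs)) (word_op q (zip js xs) v))"
    by (simp add: X_balanced_def exps_def path_weight_def word_op_def)
  then show ?thesis
    by (simp, intro diagonal_sum diagonal_word_op[OF q]) (simp add: exps_def shift_zip)
qed

definition XA_poly :: "real \<Rightarrow> real \<Rightarrow> (nat \<times> nat) list \<Rightarrow> nat list \<Rightarrow> nat \<Rightarrow> real poly" where
  "XA_poly q \<mu> xs ds N =
     (\<Sum>ns\<in>exps (length ds) N. \<Sum>js\<in>exps (length xs + length ds) (sum_list (map fst xs) + sum_list ds).
       smult (path_weight q \<mu> js (xs @ zip ds ns)) (path_poly q (zip js (xs @ zip ds ns))))"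

lemma diagonal_XA_balanced:
  assumes q: "q \<noteq> 0"
  shows "diagonal q (XA_poly q \<mu> xs ds N) (XA_balanced q \<mu> xs ds N)"
proof -
  have "XA_balanced q \<mu> xs ds N =
    (\<lambda>v. \<Sum>ns\<in>exps (length ds) N. smult (of_real 1) (X_balanced q \<mu> (xs @ zip ds ns) v))"
    by (simp add: XA_balanced_def exps_def)
  moreover have "diagonal q
    (\<Sum>ns\<in>exps (length ds) N. smult 1
      (\<Sum>js\<in>exps (length xs + length ds) (sum_list (map fst xs) + sum_list ds).
         smult (path_weight q \<mu> js (xs @ zip ds ns)) (path_poly q (zip js (xs @ zip ds ns)))))
    (\<lambda>v. \<Sum>ns\<in>exps (length ds) N. smult (of_real 1) (X_balanced q \<mu> (xs @ zip ds ns) v))"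
  proof (rule diagonal_sum)
    fix ns assume "ns \<in> exps (length ds) N"
    then have "length ds = length ns" by (simp add: exps_def)
    then show "diagonal q (\<Sum>js\<in>exps (length xs + length ds) (sum_list (map fst xs) + sum_list ds).
         smult (path_weight q \<mu> js (xs @ zip ds ns)) (path_poly q (zip js (xs @ zip ds ns))))
      (X_balanced q \<mu> (xs @ zip ds ns))"
      using diagonal_X_balanced[OF q, of \<mu> "xs @ zip ds ns"] by simp
  qed
  ultimately show ?thesis by (simp add: XA_poly_def)
qed

lemma Tr_series_eq:
  assumes q: "0 < q" "q < 1"
  shows "Tr_series q \<mu> y xs ds N = of_real (y ^ N * k_trace q (XA_poly q \<mu> xs ds N))"
  using diagonal_qb_Tr[OF q diagonal_XA_balanced] q by (simp add: Tr_series_def)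

subsection \<open>A coefficient norm\<close>

text \<open>A weighted l^1 norm in which k has size x. It is meant for the tail of the trace, where
  each coefficient of p meets its own factor 1/(1 - q^u) and cancellation between coefficients is
  lost.\<close>

definition coeff_norm :: "real \<Rightarrow> real poly \<Rightarrow> real" where
  "coeff_norm x p = (\<Sum>u\<le>degree p. \<bar>coeff p u\<bar> * x ^ u)"

lemma coeff_norm_eq:
  assumes "degree p \<le> n"
  shows "coeff_norm x p = (\<Sum>u\<le>n. \<bar>coeff p u\<bar> * x ^ u)"
  unfolding coeff_norm_def
  by (rule sum.mono_neutral_left) (use assms in \<open>auto simp: coeff_eq_0\<close>)

lemma coeff_norm_nonneg: "0 \<le> x \<Longrightarrow> 0 \<le> coeff_norm x p"
  by (simp add: coeff_norm_def sum_nonneg)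

lemma coeff_norm_0 [simp]: "coeff_norm x 0 = 0"
  by (simp add: coeff_norm_def)

lemma coeff_norm_1 [simp]: "coeff_norm x 1 = 1"
  by (simp add: coeff_norm_def)

lemma coeff_norm_add:
  assumes "0 \<le> x"
  shows "coeff_norm x (p + p') \<le> coeff_norm x p + coeff_norm x p'"
proof -
  let ?n = "max (degree p) (degree p')"
  have "coeff_norm x (p + p') = (\<Sum>u\<le>?n. \<bar>coeff p u + coeff p' u\<bar> * x ^ u)"
    using coeff_norm_eq[OF degree_add_le_max] by simp
  also have "\<dots> \<le> (\<Sum>u\<le>?n. \<bar>coeff p u\<bar> * x ^ u + \<bar>coeff p' u\<bar> * x ^ u)"
    using assms by (intro sum_mono) (simp flip: distrib_right add: mult_right_mono)
  also have "\<dots> = coeff_norm x p + coeff_norm x p'"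
    by (simp add: sum.distrib coeff_norm_eq[of _ ?n])
  finally show ?thesis .
qed

lemma coeff_norm_smult: "coeff_norm x (smult c p) = \<bar>c\<bar> * coeff_norm x p"
  using coeff_norm_eq[OF degree_smult_le, of x c p]
  by (simp add: coeff_norm_def abs_mult sum_distrib_left mult.assoc)

lemma coeff_norm_sum:
  assumes "0 \<le> x"
  shows "coeff_norm x (\<Sum>i\<in>I. p i) \<le> (\<Sum>i\<in>I. coeff_norm x (p i))"
  by (induction I rule: infinite_finite_induct)
    (auto intro: order_trans[OF coeff_norm_add[OF assms]])

lemma coeff_norm_pCons: "coeff_norm x (pCons c p) = \<bar>c\<bar> + x * coeff_norm x p"
proof -
  have "coeff_norm x (pCons c p) = (\<Sum>u\<le>Suc (degree p). \<bar>coeff (pCons c p) u\<bar> * x ^ u)"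
    by (rule coeff_norm_eq) (simp add: degree_pCons_le)
  also have "\<dots> = \<bar>c\<bar> + (\<Sum>u\<le>degree p. \<bar>coeff p u\<bar> * x ^ Suc u)"
    unfolding sum.atMost_Suc_shift by simp
  finally show ?thesis by (simp add: coeff_norm_def sum_distrib_left mult.left_commute)
qed

lemma coeff_norm_mult_linear:
  assumes "0 \<le> x"
  shows "coeff_norm x (p * [:1, e:]) \<le> coeff_norm x p * (1 + \<bar>e\<bar> * x)"
proof -
  have "p * [:1, e:] = p + smult e (pCons 0 p)" by (simp add: mult.commute[of p] mult_pCons_left)
  then show ?thesis
    using coeff_norm_add[OF assms, of p "smult e (pCons 0 p)"]
    by (simp add: coeff_norm_smult coeff_norm_pCons algebra_simps del: smult_pCons)
qed

lemma coeff_norm_mult_monom: "coeff_norm x (p * monom c n) = coeff_norm x p * (\<bar>c\<bar> * x ^ n)"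
proof (induction n)
  case 0
  then show ?case by (simp add: monom_0 mult.commute[of p] coeff_norm_smult)
next
  case (Suc n)
  then show ?case by (simp add: monom_Suc mult.commute[of p] coeff_norm_pCons)
qed

text \<open>
  The series of the 1/(1 - q^u) are split after D terms: in the application, p has factors
  1 - k q^s with s >= -D, so the coefficient norm is under control only at q^D.
\<close>

lemma abs_k_trace_minus_poly:
  assumes q: "0 < q" "q < 1" and D: "1 \<le> D"
    and ev: "\<And>m. 1 \<le> m \<Longrightarrow> \<bar>poly p (q ^ m)\<bar> \<le> M" and norm: "coeff_norm (q ^ D) p \<le> M"
  shows "\<bar>k_trace q p - poly p 1\<bar> \<le> (2 * real D + 1 / (1 - q)) * M"
proof -
  define p0 where "p0 = coeff p 0"
  have ev': "poly p (q ^ m) - p0 = (\<Sum>u=1..degree p. coeff p u * (q ^ u) ^ m)" for m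
  proof -
    have "poly p (q ^ m) = (\<Sum>u\<le>degree p. coeff p u * (q ^ u) ^ m)"
      by (simp add: poly_altdef mult.commute flip: power_mult)
    then show ?thesis by (simp add: p0_def atMost_atLeast0 sum.atLeast_Suc_atMost)
  qed
  have "k_trace q p = (\<Sum>u=1..degree p. coeff p u * ((\<Sum>m<D. (q ^ u) ^ m) + (q ^ u) ^ D / (1 - q ^ u)))"
    unfolding k_trace_def
  proof (rule sum.cong)
    fix u assume "u \<in> {1..degree p}"
    then have "q ^ u < 1" using q by (simp add: power_less_one_iff)
    then show "coeff p u / (1 - q ^ u) = coeff p u * ((\<Sum>m<D. (q ^ u) ^ m) + (q ^ u) ^ D / (1 - q ^ u))"
      by (simp add: sum_gp_strict divide_simps)
  qed simp
  also have "\<dots> = (\<Sum>m<D. poly p (q ^ m) - p0) + (\<Sum>u=1..degree p. coeff p u * ((q ^ D) ^ u / (1 - q ^ u)))"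
    unfolding ev' by (subst sum.swap) (simp add: distrib_left sum.distrib sum_distrib_left mult.commute flip: power_mult)
  \<comment> \<open>The term m = 0 is p(1), the vacuum part that the lemma subtracts; p0 is
    collected D times.\<close>
  also have "(\<Sum>m<D. poly p (q ^ m) - p0) = poly p 1 + (\<Sum>m\<in>{1..<D}. poly p (q ^ m)) - real D * p0"
    using D by (simp add: sum_subtractf lessThan_atLeast0 sum.atLeast_Suc_lessThan)
  finally have eq: "k_trace q p - poly p 1 = (\<Sum>m\<in>{1..<D}. poly p (q ^ m)) - real D * p0 +
      (\<Sum>u=1..degree p. coeff p u * ((q ^ D) ^ u / (1 - q ^ u)))" by simp
  have M: "0 \<le> M" using norm coeff_norm_nonneg[of "q ^ D" p] q by simp
  have "\<bar>\<Sum>m\<in>{1..<D}. poly p (q ^ m)\<bar> \<le> (\<Sum>m\<in>{1..<D}. M)"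
    by (rule order_trans[OF sum_abs sum_mono]) (use ev in auto)
  also have "\<dots> \<le> real D * M" using M by (simp add: mult_right_mono)
  finally have 1: "\<bar>\<Sum>m\<in>{1..<D}. poly p (q ^ m)\<bar> \<le> real D * M" .
  have "\<bar>p0\<bar> \<le> coeff_norm (q ^ D) p"
    unfolding coeff_norm_def p0_def using q
    by (subst sum.atMost_shift) (simp add: sum_nonneg)
  then have 2: "\<bar>real D * p0\<bar> \<le> real D * M" using norm by (simp add: abs_mult mult_left_mono)
  have "\<bar>\<Sum>u=1..degree p. coeff p u * ((q ^ D) ^ u / (1 - q ^ u))\<bar> \<le>
      (\<Sum>u=1..degree p. \<bar>coeff p u\<bar> * (q ^ D) ^ u * (1 / (1 - q)))"
  proof (rule order_trans[OF sum_abs sum_mono])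
    fix u assume u: "u \<in> {1..degree p}"
    then have "q ^ u \<le> q" using q power_decreasing[of 1 u q] by simp
    then have "1 / (1 - q ^ u) \<le> 1 / (1 - q)" using q by (intro divide_left_mono) auto
    moreover have "0 \<le> 1 / (1 - q ^ u)" using q u \<open>q ^ u \<le> q\<close> by simp
    moreover have "\<bar>coeff p u * ((q ^ D) ^ u / (1 - q ^ u))\<bar> = \<bar>coeff p u\<bar> * (q ^ D) ^ u * \<bar>1 / (1 - q ^ u)\<bar>"
      using q by (simp add: abs_mult)
    ultimately show "\<bar>coeff p u * ((q ^ D) ^ u / (1 - q ^ u))\<bar> \<le> \<bar>coeff p u\<bar> * (q ^ D) ^ u * (1 / (1 - q))"
      using q by (metis abs_ge_zero abs_of_nonneg mult_left_mono mult_nonneg_nonneg order_less_imp_le zero_le_power)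
  qed
  also have "\<dots> \<le> coeff_norm (q ^ D) p * (1 / (1 - q))"
    unfolding coeff_norm_def sum_distrib_right using q by (intro sum_mono2) auto
  also have "\<dots> \<le> M * (1 / (1 - q))" using norm q by (intro mult_right_mono) auto
  finally have 3: "\<bar>\<Sum>u=1..degree p. coeff p u * ((q ^ D) ^ u / (1 - q ^ u))\<bar> \<le> M * (1 / (1 - q))" .
  \<comment> \<open>One D comes from the values at 1 <= m < D, the other from p0, and 1/(1 - q) from
    the tail, where q^u <= q.\<close>
  show ?thesis unfolding eq using 1 2 3 by (simp add: algebra_simps)
qed

text \<open>A letter b^j k^n c^a either kills the state or multiplies the matrix element by q^(ln)
  times a product of factors 1 - q^i, a number in [0, 1].\<close>

lemma poly_path_poly_Cons_bounds:
  assumes q: "0 < q" "q < (1::real)" and w: "0 \<le> poly (path_poly q w) (q ^ m)"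
  shows "0 \<le> poly (path_poly q (x # w)) (q ^ m) \<and>
    poly (path_poly q (x # w)) (q ^ m) \<le> poly (path_poly q w) (q ^ m)"
proof -
  obtain j a n where x: "x = (j, a, n)" by (cases x)
  show ?thesis
  proof (cases "int m + shift w - int a < 0")
    case True
    have "poly (path_poly q (x # w)) (q ^ m) = 0"
      unfolding x by (rule path_poly_eq_0[OF _ True path_poly_vanishes]) (use q in auto)
    then show ?thesis using w by simp
  next
    case False
    then obtain l where l: "int l = int m + shift w - int a" by (metis not_less zero_le_imp_eq_int)
    have "0 \<le> 1 - q ^ i \<and> 1 - q ^ i \<le> 1" for i using q by (simp add: power_le_one)
    then have "0 \<le> lowering q a (l + a)" "lowering q a (l + a) \<le> 1"
      unfolding lowering_def by (auto intro!: prod_nonneg prod_le_1)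
    then have "0 \<le> (q ^ l) ^ n * lowering q a (l + a)" "(q ^ l) ^ n * lowering q a (l + a) \<le> 1"
      using q by (auto intro!: mult_le_one simp: power_le_one simp flip: power_mult)
    then show ?thesis
      using w q unfolding x by (subst (1 2) poly_path_poly_Cons_nat[OF _ l]) (auto intro: mult_left_le)
  qed
qed

lemma power_power_int_le_1:
  assumes "0 < q" "q < (1::real)" "0 \<le> int D + s"
  shows "q ^ D * q powi s \<le> 1" "0 \<le> q ^ D * q powi s"
proof -
  obtain l where l: "int l = int D + s" using assms(3) by (metis zero_le_imp_eq_int)
  have "q ^ D * q powi s = q ^ l" by (rule power_int_shift[OF _ l]) (use assms in simp)
  then show "q ^ D * q powi s \<le> 1" "0 \<le> q ^ D * q powi s" using assms by (simp_all add: power_le_one)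
qed

text \<open>The hypothesis keeps every exponent s in this letter at least -D. Hence 1 - k q^s has
  norm at most 2 at q^D, and (k q^s)^n has norm at most 1.\<close>

lemma coeff_norm_path_poly_Cons:
  assumes q: "0 < q" "q < (1::real)" and D: "int a \<le> int D + shift w"
  shows "coeff_norm (q ^ D) (path_poly q ((j, a, n) # w)) \<le> 2 ^ a * coeff_norm (q ^ D) (path_poly q w)"
proof -
  let ?x = "q ^ D"
  have x: "0 \<le> ?x" using q by simp
  have prod: "coeff_norm ?x (p * (\<Prod>i<b. [:1, - (q powi (shift w - int i)):])) \<le> 2 ^ b * coeff_norm ?x p"
    if "b \<le> a" for b p
    using that
  proof (induction b)
    case (Suc b)
    have "coeff_norm ?x (p * (\<Prod>i<Suc b. [:1, - (q powi (shift w - int i)):])) \<le>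
      coeff_norm ?x (p * (\<Prod>i<b. [:1, - (q powi (shift w - int i)):])) * (1 + \<bar>- (q powi (shift w - int b))\<bar> * ?x)"
      unfolding prod.lessThan_Suc mult.assoc[symmetric] by (rule coeff_norm_mult_linear[OF x])
    also have "\<dots> \<le> (2 ^ b * coeff_norm ?x p) * 2"
    proof (rule mult_mono)
      have "q ^ D * q powi (shift w - int b) \<le> 1"
        by (rule power_power_int_le_1[OF q]) (use D Suc in auto)
      then show "1 + \<bar>- (q powi (shift w - int b))\<bar> * ?x \<le> 2"
        using q by (simp add: mult.commute)
    qed (use Suc coeff_norm_nonneg[OF x] q in \<open>auto intro!: add_nonneg_nonneg\<close>)
    finally show ?case by simp
  qed simp
  have "?x * q powi (shift w - int a) \<le> 1" "0 \<le> ?x * q powi (shift w - int a)"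
    by (rule power_power_int_le_1[OF q]; use D in simp)+
  then have "\<bar>(q powi (shift w - int a)) ^ n\<bar> * ?x ^ n \<le> 1"
    using q by (simp add: power_abs mult.commute power_le_one flip: power_mult_distrib)
  then have "coeff_norm ?x (path_poly q w * monom ((q powi (shift w - int a)) ^ n) n) \<le> coeff_norm ?x (path_poly q w)"
    unfolding coeff_norm_mult_monom by (rule mult_left_le) (rule coeff_norm_nonneg[OF x])
  then show ?thesis using order_trans[OF prod[OF order_refl]] by simp
qed

definition lowerings :: "(nat \<times> nat \<times> nat) list \<Rightarrow> nat" where
  "lowerings w = (\<Sum>(j, a, n)\<leftarrow>w. a)"

definition k_degree :: "(nat \<times> nat \<times> nat) list \<Rightarrow> nat" where
  "k_degree w = (\<Sum>(j, a, n)\<leftarrow>w. n)"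

lemma lowerings_simps [simp]:
  "lowerings [] = 0" "lowerings ((j, a, n) # w) = a + lowerings w" "lowerings (v @ w) = lowerings v + lowerings w"
  by (simp_all add: lowerings_def)

lemma k_degree_simps [simp]: "k_degree [] = 0" "k_degree ((j, a, n) # w) = n + k_degree w"
  by (simp_all add: k_degree_def)

lemma shift_ge: "- int (lowerings w) \<le> shift w"
  by (induction w) auto

text \<open>Without c every partial word has nonnegative shift, so each k meets a state at or above
  |m> and gives at most q^m. The polynomial is a monomial with coefficient at most 1.\<close>

lemma path_poly_raising:
  assumes q: "0 < q" "q < (1::real)" and w: "lowerings w = 0"
  shows "0 \<le> poly (path_poly q w) (q ^ m) \<and> poly (path_poly q w) (q ^ m) \<le> (q ^ m) ^ k_degree w \<and>
    coeff_norm (q ^ D) (path_poly q w) \<le> (q ^ D) ^ k_degree w"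
  using w
proof (induction w)
  case (Cons x w)
  obtain j n where x: "x = (j, 0, n)" using Cons.prems by (cases x) auto
  have s: "0 \<le> shift w" using shift_ge[of w] Cons x by simp
  have e: "0 \<le> q powi shift w" "q powi shift w \<le> 1"
    using power_power_int_le_1[OF q, of 0 "shift w"] s by auto
  have le: "(z * q powi shift w) ^ n \<le> z ^ n" if "0 \<le> z" for z
    using that e by (intro power_mono) (auto intro: mult_left_le)
  have "poly (path_poly q (x # w)) (q ^ m) = poly (path_poly q w) (q ^ m) * (q ^ m * q powi shift w) ^ n"
    unfolding x by (subst poly_path_poly_Cons) simp
  moreover have "poly (path_poly q w) (q ^ m) * (q ^ m * q powi shift w) ^ n \<le> (q ^ m) ^ k_degree w * (q ^ m) ^ n"
    using le[of "q ^ m"] Cons x e q by (intro mult_mono) auto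
  moreover have "coeff_norm (q ^ D) (path_poly q w) * (\<bar>(q powi shift w) ^ n\<bar> * (q ^ D) ^ n) \<le>
      (q ^ D) ^ k_degree w * (q ^ D) ^ n"
    using le[of "q ^ D"] Cons x e q
    by (intro mult_mono) (auto simp: power_mult_distrib mult.commute)
  ultimately show ?case
    using Cons x e q by (simp add: coeff_norm_mult_monom power_add ac_simps poly_monom power_mult_distrib)
qed simp

text \<open>In the application w is the final block of A_0's, which acts first and supplies the
  decay, and v contains all the c's. Prepending v does not increase the values and costs at most a
  factor 2 per c in the norm.\<close>

lemma path_poly_append_bounds:
  assumes q: "0 < q" "q < (1::real)" and D: "lowerings (v @ w) \<le> D" and w: "lowerings w = 0"
  shows "0 \<le> poly (path_poly q (v @ w)) (q ^ m) \<and> poly (path_poly q (v @ w)) (q ^ m) \<le> (q ^ m) ^ k_degree w \<and>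
    coeff_norm (q ^ D) (path_poly q (v @ w)) \<le> 2 ^ lowerings v * (q ^ D) ^ k_degree w"
  using D
proof (induction v)
  case Nil
  then show ?case using path_poly_raising[OF q w] by simp
next
  case (Cons x v)
  obtain j a n where x: "x = (j, a, n)" by (cases x)
  have IH: "0 \<le> poly (path_poly q (v @ w)) (q ^ m)" "poly (path_poly q (v @ w)) (q ^ m) \<le> (q ^ m) ^ k_degree w"
    "coeff_norm (q ^ D) (path_poly q (v @ w)) \<le> 2 ^ lowerings v * (q ^ D) ^ k_degree w"
    using Cons x by auto
  have "coeff_norm (q ^ D) (path_poly q ((j, a, n) # v @ w)) \<le> 2 ^ a * coeff_norm (q ^ D) (path_poly q (v @ w))"
    by (rule coeff_norm_path_poly_Cons[OF q]) (use shift_ge[of "v @ w"] Cons.prems x in auto)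
  also have "\<dots> \<le> 2 ^ a * (2 ^ lowerings v * (q ^ D) ^ k_degree w)"
    using IH by (intro mult_left_mono) auto
  finally have "coeff_norm (q ^ D) (path_poly q ((j, a, n) # v @ w)) \<le> 2 ^ (a + lowerings v) * (q ^ D) ^ k_degree w"
    by (simp add: power_add)
  then show ?case using poly_path_poly_Cons_bounds[OF q IH(1), of x] IH(2) x by auto
qed

section \<open>Generating functions of the weights\<close>

definition conv :: "(nat \<Rightarrow> real) list \<Rightarrow> nat \<Rightarrow> real" where
  "conv fs N = (\<Sum>ns\<in>exps (length fs) N. prod_list (map2 (\<lambda>f n. f n) fs ns))"

lemma conv_Cons: "conv (f # fs) N = (\<Sum>n\<le>N. f n * conv fs (N - n))"
  by (simp add: conv_def sum_exps_Suc sum_distrib_left)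

lemma conv_nonneg:
  assumes "\<And>f n. f \<in> set fs \<Longrightarrow> 0 \<le> f n"
  shows "0 \<le> conv fs N"
  using assms
proof (induction fs arbitrary: N)
  case (Cons f fs)
  then show ?case by (auto simp: conv_Cons intro!: sum_nonneg)
qed (simp add: conv_def exps_0)

lemma conv_sums:
  assumes "\<And>f n. f \<in> set fs \<Longrightarrow> 0 \<le> f n" and "\<And>f. f \<in> set fs \<Longrightarrow> summable (\<lambda>n. f n * z ^ n)" and z: "0 \<le> z"
  shows "(\<lambda>N. conv fs N * z ^ N) sums (\<Prod>f\<leftarrow>fs. \<Sum>n. f n * z ^ n)"
  using assms(1,2)
proof (induction fs)
  case Nil
  have "(\<lambda>N. conv [] N * z ^ N) = (\<lambda>N. if N = 0 then 1 else 0)" by (auto simp: conv_def exps_0)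
  then show ?case using sums_single[of 0 "\<lambda>_. 1::real"] by simp
next
  case (Cons f fs)
  have IH: "(\<lambda>N. conv fs N * z ^ N) sums (\<Prod>f\<leftarrow>fs. \<Sum>n. f n * z ^ n)" using Cons by simp
  have "(\<lambda>N. \<Sum>n\<le>N. (f n * z ^ n) * (conv fs (N - n) * z ^ (N - n))) sums
     ((\<Sum>n. f n * z ^ n) * (\<Sum>N. conv fs N * z ^ N))"
    using Cons.prems z IH conv_nonneg[of fs]
    by (intro Cauchy_product_sums) (auto simp: abs_mult sums_iff)
  moreover have "(\<Sum>n\<le>N. (f n * z ^ n) * (conv fs (N - n) * z ^ (N - n))) = conv (f # fs) N * z ^ N" for N
    unfolding conv_Cons sum_distrib_right
    by (rule sum.cong) (auto simp: ac_simps simp flip: power_add)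
  ultimately show ?case using IH by (simp add: sums_iff)
qed

definition x_weight :: "real \<Rightarrow> real \<Rightarrow> nat \<Rightarrow> nat \<Rightarrow> real" where
  "x_weight q \<mu> a n = qpoch q \<mu> (a + n) / (qpoch q q a * qpoch q q n)"

lemma x_coeff_eq: "x_coeff q \<mu> j (a, n) = x_weight q \<mu> a n * g q \<mu> j"
  by (simp add: x_coeff_def x_weight_def)

lemma x_weight_0: "x_weight q \<mu> 0 = g q \<mu>"
  by (auto simp: x_weight_def g_def qpoch_def fun_eq_iff)

text \<open>The weight splits into a factor for the exponents of k and one for the exponents of b,
  so that the double sum over \<open>ns\<close> and \<open>js\<close> in the trace bound becomes a
  product.\<close>

lemma path_weight_eq:
  assumes "length js = length xs"
  shows "path_weight q \<mu> js xs = (\<Prod>(a, n)\<leftarrow>xs. x_weight q \<mu> a n) * prod_list (map (g q \<mu>) js)"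
  using assms unfolding path_weight_def
  by (induction js xs rule: list_induct2) (auto simp: x_coeff_eq ac_simps)

text \<open>A_a is the product of the sum of the g_j b^j, of \<open>x_series q \<mu> a\<close> at y
  k, and of c^a. For a = 0 this series is K.\<close>

definition x_series :: "real \<Rightarrow> real \<Rightarrow> nat \<Rightarrow> real \<Rightarrow> real" where
  "x_series q \<mu> a z = (\<Sum>n. x_weight q \<mu> a n * z ^ n)"

locale q_params =
  fixes q \<mu> y :: real
  assumes q: "0 < q" "q < 1" and mu: "0 < \<mu>" "\<mu> < 1" and y: "0 < y" "y < 1"
begin

lemma qpoch_pos:
  assumes "z < 1"
  shows "0 < qpoch q z m"
  unfolding qpoch_def
proof (intro prod_pos ballI)
  fix j
  have "q ^ j \<le> 1" "0 < q ^ j" using q by (simp_all add: power_le_one)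
  then have "z * q ^ j < 1"
    using assms by (cases "0 \<le> z") (auto intro: order_le_less_trans[OF mult_left_le] simp: mult_neg_pos less_trans[of _ 0 1])
  then show "0 < 1 - z * q ^ j" by simp
qed

lemma x_weight_pos: "0 < x_weight q \<mu> a n"
  using qpoch_pos q mu by (simp add: x_weight_def)

lemma g_pos: "0 < g q \<mu> n"
  using x_weight_pos[of 0 n] by (simp add: x_weight_0)

lemma g_0 [simp]: "g q \<mu> 0 = 1"
  by (simp add: g_def qpoch_def)

lemma x_weight_Suc: "x_weight q \<mu> a (Suc n) * (1 - q ^ Suc n) = x_weight q \<mu> a n * (1 - \<mu> * q ^ (a + n))"
proof -
  have "qpoch q q (Suc n) = qpoch q q n * (1 - q ^ Suc n)" by (simp add: qpoch_def)
  moreover have "qpoch q \<mu> (a + Suc n) = qpoch q \<mu> (a + n) * (1 - \<mu> * q ^ (a + n))" by (simp add: qpoch_def)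
  moreover have "0 < qpoch q q a" "0 < qpoch q q n" "0 < 1 - q ^ Suc n"
    using qpoch_pos[of q] q power_less_one_iff[of q "Suc n"] by (auto simp del: power_Suc)
  ultimately show ?thesis unfolding x_weight_def by (simp del: power_Suc add_Suc_right)
qed

lemma summable_x_series:
  assumes z: "\<bar>z\<bar> < 1"
  shows "summable (\<lambda>n. x_weight q \<mu> a n * z ^ n)"
proof (cases "z = 0")
  case True
  then show ?thesis by simp
next
  case False
  \<comment> \<open>A number strictly between |z| and 1; the ratios of consecutive terms tend to |z|
    in absolute value.\<close>
  define c where "c = (1 + \<bar>z\<bar>) / 2"
  have c: "\<bar>z\<bar> < c" "c < 1" "0 < c" using z by (auto simp: c_def)
  have "(\<lambda>n. 1 - q ^ Suc n) \<longlonglongrightarrow> 1 - 0"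
    by (intro tendsto_diff tendsto_const LIMSEQ_Suc LIMSEQ_realpow_zero) (use q in auto)
  moreover have "\<bar>z\<bar> / c < 1" using c by simp
  ultimately have "\<forall>\<^sub>F n in sequentially. \<bar>z\<bar> / c < 1 - q ^ Suc n"
    by (auto elim: order_tendstoD)
  then obtain n0 where n0: "\<bar>z\<bar> / c < 1 - q ^ Suc n" if "n \<ge> n0" for n
    by (auto simp: eventually_sequentially)
  show ?thesis
  proof (rule summable_ratio_test[OF c(2)])
    fix n assume n: "n0 \<le> n"
    have pos: "0 < 1 - q ^ Suc n" using q power_less_one_iff[of q "Suc n"] by (auto simp del: power_Suc)
    have "x_weight q \<mu> a (Suc n) * (1 - q ^ Suc n) \<le> x_weight q \<mu> a n"
      unfolding x_weight_Suc using x_weight_pos[of a n] mu q by (intro mult_left_le) auto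
    then have "x_weight q \<mu> a (Suc n) \<le> x_weight q \<mu> a n / (1 - q ^ Suc n)" using pos by (simp add: field_simps)
    moreover have "\<bar>z\<bar> / (1 - q ^ Suc n) \<le> c"
      using n0[OF n] pos c by (simp add: field_simps)
    ultimately have "x_weight q \<mu> a (Suc n) * \<bar>z\<bar> \<le> x_weight q \<mu> a n / (1 - q ^ Suc n) * \<bar>z\<bar>"
      by (intro mult_right_mono) auto
    also have "\<dots> = x_weight q \<mu> a n * (\<bar>z\<bar> / (1 - q ^ Suc n))" by simp
    also have "\<dots> \<le> x_weight q \<mu> a n * c"
      using \<open>\<bar>z\<bar> / (1 - q ^ Suc n) \<le> c\<close> x_weight_pos[of a n] by (intro mult_left_mono) auto
    finally have "x_weight q \<mu> a (Suc n) * \<bar>z\<bar> * \<bar>z\<bar> ^ n \<le> x_weight q \<mu> a n * c * \<bar>z\<bar> ^ n"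
      by (intro mult_right_mono) auto
    then show "norm (x_weight q \<mu> a (Suc n) * z ^ Suc n) \<le> c * norm (x_weight q \<mu> a n * z ^ n)"
      using x_weight_pos[of a] by (simp add: abs_mult power_abs abs_of_pos ac_simps)
  qed
qed

lemma x_series_sums:
  assumes "\<bar>z\<bar> < 1"
  shows "(\<lambda>n. x_weight q \<mu> a n * z ^ n) sums x_series q \<mu> a z"
  using summable_x_series[OF assms] by (simp add: x_series_def summable_sums)

lemma x_series_pos:
  assumes "0 \<le> z" "z < 1"
  shows "0 < x_series q \<mu> a z"
proof -
  have "0 \<le> x_weight q \<mu> a n * z ^ n" for n using x_weight_pos[of a n] assms by simp
  then show ?thesis
    unfolding x_series_def using assms x_weight_pos[of a 0]
    by (intro suminf_pos2[where i = 0] summable_x_series) auto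
qed

lemma x_series_less:
  assumes "0 \<le> z" "z < z'" "z' < 1"
  shows "x_series q \<mu> a z < x_series q \<mu> a z'"
proof -
  have "(\<lambda>n. x_weight q \<mu> a n * z' ^ n - x_weight q \<mu> a n * z ^ n) sums (x_series q \<mu> a z' - x_series q \<mu> a z)"
    using assms by (intro sums_diff x_series_sums) auto
  moreover have "0 \<le> x_weight q \<mu> a n * z' ^ n - x_weight q \<mu> a n * z ^ n" for n
    using assms x_weight_pos[of a n] by (simp add: mult_left_mono power_mono)
  moreover have "0 < x_weight q \<mu> a 1 * z' ^ 1 - x_weight q \<mu> a 1 * z ^ 1"
    using assms x_weight_pos[of a 1] by simp
  ultimately show ?thesis
    using suminf_pos2[where i = 1 and f = "\<lambda>n. x_weight q \<mu> a n * z' ^ n - x_weight q \<mu> a n * z ^ n"]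
    by (simp add: sums_iff)
qed

lemma x_series_tendsto_0: "(x_series q \<mu> a \<longlongrightarrow> x_weight q \<mu> a 0) (at 0)"
  using powser_limit_0[of 1 "x_weight q \<mu> a"] x_series_sums by simp

end

subsection \<open>The trace is close to the vacuum expectation\<close>

text \<open>Used at z = q: the gain z^n of each final A_0 is absorbed into its weights, so that its
  generating function at y becomes K(y z).\<close>

lemma zip_weights_eq:
  assumes "length ns = length pre + R"
  shows "(\<Prod>(a, n)\<leftarrow>zip (pre @ replicate R 0) ns. x_weight q \<mu> a n) * z ^ sum_list (drop (length pre) ns) =
    prod_list (map2 (\<lambda>f n. f n)
      (map (x_weight q \<mu>) pre @ replicate R (\<lambda>n. x_weight q \<mu> 0 n * z ^ n)) ns)"
  using assms
proof (induction pre arbitrary: ns)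
  case Nil
  then show ?case
  proof (induction R arbitrary: ns)
    case (Suc R)
    then obtain n ns' where ns: "ns = n # ns'" by (cases ns) auto
    show ?case using Suc.IH[of ns'] Suc.prems ns by (simp add: power_add ac_simps)
  qed simp
next
  case (Cons a pre)
  then obtain n ns' where ns: "ns = n # ns'" by (cases ns) auto
  show ?case using Cons.IH[of ns'] Cons.prems ns by (simp add: mult.assoc)
qed

lemma lowerings_zip:
  assumes "length js = length xs"
  shows "lowerings (zip js xs) = sum_list (map fst xs)"
  using assms by (induction js xs rule: list_induct2) auto

lemma k_degree_zip:
  assumes "length js = length xs"
  shows "k_degree (zip js xs) = sum_list (map snd xs)"
  using assms by (induction js xs rule: list_induct2) auto

lemma zip_path_append:
  assumes "length js = length xs + length pre + R" "length ns = length pre + R"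
  defines "v \<equiv> zip (take (length xs + length pre) js) (xs @ zip pre (take (length pre) ns))"
  defines "w \<equiv> zip (drop (length xs + length pre) js) (zip (replicate R 0) (drop (length pre) ns))"
  shows "zip js (xs @ zip (pre @ replicate R 0) ns) = v @ w"
    and "lowerings v = sum_list (map fst xs) + sum_list pre"
    and "lowerings w = 0" and "k_degree w = sum_list (drop (length pre) ns)"
proof -
  have "zip (pre @ replicate R 0) ns = zip pre (take (length pre) ns) @ zip (replicate R 0) (drop (length pre) ns)"
    by (rule zip_append1)
  then show "zip js (xs @ zip (pre @ replicate R 0) ns) = v @ w"
    using assms zip_append2[of js "xs @ zip pre (take (length pre) ns)"] by simp
qed (use assms in \<open>auto simp: lowerings_zip k_degree_zip sum_list_replicate\<close>)

text \<open>A Cauchy estimate: the left side is the coefficient of t^M in K(t)^k, whose coefficients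
  are all nonnegative. For fixed M it grows only polynomially in k, but an exponential bound with
  base K(t) close to 1 suffices.\<close>

lemma (in q_params) sum_g_le:
  assumes t: "0 < t" "t < 1"
  shows "(\<Sum>js\<in>exps k M. prod_list (map (g q \<mu>) js)) \<le> inverse (t ^ M) * x_series q \<mu> 0 t ^ k"
proof -
  let ?fs = "replicate k (g q \<mu>)"
  have "map2 (\<lambda>f n. f n) (replicate k (g q \<mu>)) js = map (g q \<mu>) js" if "length js = k" for js
    using that by (induction js arbitrary: k) auto
  then have eq: "(\<Sum>js\<in>exps k M. prod_list (map (g q \<mu>) js)) = conv ?fs M"
    unfolding conv_def by (auto simp: exps_def intro!: sum.cong)
  have nonneg: "0 \<le> conv ?fs N" for N using g_pos by (intro conv_nonneg) (auto intro: less_imp_le)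
  have "(\<lambda>N. conv ?fs N * t ^ N) sums (\<Prod>f\<leftarrow>?fs. \<Sum>n. f n * t ^ n)"
  proof (rule conv_sums)
    show "f \<in> set ?fs \<Longrightarrow> summable (\<lambda>n. f n * t ^ n)" for f
      using summable_x_series[of t 0] t by (auto simp: x_weight_0 split: if_splits)
  qed (use g_pos t in \<open>auto intro: less_imp_le\<close>)
  moreover have "(\<Prod>f\<leftarrow>?fs. \<Sum>n. f n * t ^ n) = x_series q \<mu> 0 t ^ k"
    by (simp add: x_series_def x_weight_0 prod_list_replicate)
  ultimately have "conv ?fs M * t ^ M \<le> x_series q \<mu> 0 t ^ k"
    using sum_le_suminf[of "\<lambda>N. conv ?fs N * t ^ N" "{M}"] nonneg t by (simp add: sums_iff)
  then show ?thesis unfolding eq using t by (simp add: field_simps)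
qed

text \<open>The point is that C does not depend on R. In the rate, K(t) pays for placing the D b's,
  and K(y q) appears because off the vacuum each final A_0 meets k <= q.\<close>

lemma (in q_params) k_trace_XA_poly_bound:
  fixes xs :: "(nat \<times> nat) list" and pre :: "nat list"
  defines "D \<equiv> sum_list (map fst xs) + sum_list pre"
  assumes D: "1 \<le> D" and t: "0 < t" "t < 1"
  shows "\<exists>C\<ge>0. \<forall>R. \<exists>e. (\<forall>N. \<bar>y ^ N * k_trace q (XA_poly q \<mu> xs (pre @ replicate R 0) N) -
        y ^ N * poly (XA_poly q \<mu> xs (pre @ replicate R 0) N) 1\<bar> \<le> e N) \<and>
      e sums (C * (x_series q \<mu> 0 t * x_series q \<mu> 0 (y * q)) ^ R)"
proof -
  define B where "B = x_series q \<mu> 0 t"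
  define K1 where "K1 = x_series q \<mu> 0 (y * q)"
  define c where "c = (\<Prod>(a, n)\<leftarrow>xs. x_weight q \<mu> a n)"
  \<comment> \<open>The factors are the constant of \<open>abs_k_trace_minus_poly\<close>, a 2 for
    every c in the coefficient norm, the weights of \<open>xs\<close>, and t^(-D) from
    \<open>sum_g_le\<close>.\<close>
  define C0 where "C0 = (2 * real D + 1 / (1 - q)) * 2 ^ D * c * inverse (t ^ D)"
  define C where "C = C0 * B ^ (length xs + length pre) * (\<Prod>a\<leftarrow>pre. x_series q \<mu> a y)"
  have B: "0 < B" unfolding B_def using t by (intro x_series_pos) auto
  have c: "0 \<le> c" unfolding c_def
    by (intro prod_list_nonneg) (auto intro: less_imp_le[OF x_weight_pos])
  have C0: "0 \<le> C0" unfolding C0_def using c q t by (intro mult_nonneg_nonneg add_nonneg_nonneg) auto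
  have "0 \<le> (\<Prod>a\<leftarrow>pre. x_series q \<mu> a y)"
    using y by (intro prod_list_nonneg) (auto intro: less_imp_le[OF x_series_pos])
  then have "0 \<le> C" unfolding C_def using C0 B by (intro mult_nonneg_nonneg) auto
  moreover have "\<exists>e. (\<forall>N. \<bar>y ^ N * k_trace q (XA_poly q \<mu> xs (pre @ replicate R 0) N) -
        y ^ N * poly (XA_poly q \<mu> xs (pre @ replicate R 0) N) 1\<bar> \<le> e N) \<and>
      e sums (C * (B * K1) ^ R)" for R
  proof -
    define fs where "fs = map (x_weight q \<mu>) pre @ replicate R (\<lambda>n. x_weight q \<mu> 0 n * q ^ n)"
    define k where "k = length xs + length pre + R"
    define e where "e N = C0 * B ^ k * (conv fs N * y ^ N)" for N
    have bound: "\<bar>k_trace q (XA_poly q \<mu> xs (pre @ replicate R 0) N) - poly (XA_poly q \<mu> xs (pre @ replicate R 0) N) 1\<bar>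
        \<le> C0 * B ^ k * conv fs N" for N
    proof -
      define P where "P = XA_poly q \<mu> xs (pre @ replicate R 0) N"
      define W where "W js ns = path_weight q \<mu> js (xs @ zip (pre @ replicate R 0) ns)" for js ns
      define p where "p js ns = path_poly q (zip js (xs @ zip (pre @ replicate R 0) ns))" for js ns
      define Z where "Z ns = q ^ sum_list (drop (length pre) ns)" for ns :: "nat list"
      have P: "P = (\<Sum>ns\<in>exps (length pre + R) N. \<Sum>js\<in>exps k D. smult (W js ns) (p js ns))"
        by (simp add: P_def XA_poly_def W_def p_def D_def k_def sum_list_replicate add.assoc)
      \<comment> \<open>One bound for both hypotheses of \<open>abs_k_trace_minus_poly\<close>: the
        values at q^m with m >= 1 and the norms at q^D with D >= 1 both gain the factor
        \<open>Z ns\<close>.\<close>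
      define M where "M = (\<Sum>ns\<in>exps (length pre + R) N. \<Sum>js\<in>exps k D. W js ns * (2 ^ D * Z ns))"
      have W: "W js ns = c * (\<Prod>(a, n)\<leftarrow>zip (pre @ replicate R 0) ns. x_weight q \<mu> a n) * prod_list (map (g q \<mu>) js)"
        if "ns \<in> exps (length pre + R) N" "js \<in> exps k D" for js ns
        unfolding W_def using that by (subst path_weight_eq) (auto simp: exps_def c_def k_def)
      have W_nonneg: "0 \<le> W js ns" if "ns \<in> exps (length pre + R) N" "js \<in> exps k D" for js ns
        unfolding W[OF that] using c
        by (intro mult_nonneg_nonneg prod_list_nonneg)
          (auto intro: less_imp_le[OF x_weight_pos] less_imp_le[OF g_pos])
      have pb: "\<bar>poly (p js ns) (q ^ m)\<bar> \<le> 2 ^ D * Z ns" "coeff_norm (q ^ D) (p js ns) \<le> 2 ^ D * Z ns"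
        if "ns \<in> exps (length pre + R) N" "js \<in> exps k D" "1 \<le> m" for js ns m
      proof -
        have len: "length js = length xs + length pre + R" "length ns = length pre + R"
          using that by (auto simp: exps_def k_def)
        obtain v w where z: "zip js (xs @ zip (pre @ replicate R 0) ns) = v @ w" "lowerings v = D"
          "lowerings w = 0" "k_degree w = sum_list (drop (length pre) ns)"
          using zip_path_append[OF len] unfolding D_def by blast
        have b: "0 \<le> poly (p js ns) (q ^ m)"
          "poly (p js ns) (q ^ m) \<le> (q ^ m) ^ sum_list (drop (length pre) ns)"
          "coeff_norm (q ^ D) (p js ns) \<le> 2 ^ D * (q ^ D) ^ sum_list (drop (length pre) ns)"
          using path_poly_append_bounds[OF q _ z(3), of v D m] z by (auto simp: p_def)
        have Z: "(q ^ i) ^ sum_list (drop (length pre) ns) \<le> Z ns" if "1 \<le> i" for i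
          unfolding Z_def using that q power_decreasing[of 1 i q] by (intro power_mono) auto
        have "Z ns \<le> 2 ^ D * Z ns" using q by (simp add: Z_def)
        then show "\<bar>poly (p js ns) (q ^ m)\<bar> \<le> 2 ^ D * Z ns" using b(1,2) Z[OF \<open>1 \<le> m\<close>] by simp
        show "coeff_norm (q ^ D) (p js ns) \<le> 2 ^ D * Z ns"
          using b(3) Z[OF D] by (meson mult_left_mono order_trans zero_le_numeral zero_le_power)
      qed
      have "\<bar>k_trace q P - poly P 1\<bar> \<le> (2 * real D + 1 / (1 - q)) * M"
      proof (rule abs_k_trace_minus_poly[OF q D])
        fix m :: nat assume m: "1 \<le> m"
        show "\<bar>poly P (q ^ m)\<bar> \<le> M"
          unfolding P M_def poly_sum
          by (intro order_trans[OF sum_abs] sum_mono) (use pb m W_nonneg in \<open>auto simp: abs_mult mult_left_mono\<close>)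
      next
        have "coeff_norm (q ^ D) P \<le> (\<Sum>ns\<in>exps (length pre + R) N. \<Sum>js\<in>exps k D. coeff_norm (q ^ D) (smult (W js ns) (p js ns)))"
          unfolding P using q by (intro order_trans[OF coeff_norm_sum] sum_mono coeff_norm_sum) auto
        also have "\<dots> \<le> M"
          unfolding M_def coeff_norm_smult
          by (intro sum_mono) (use pb(2)[of _ _ 1] W_nonneg in \<open>auto simp: mult_left_mono\<close>)
        finally show "coeff_norm (q ^ D) P \<le> M" .
      qed
      also have "M = (\<Sum>ns\<in>exps (length pre + R) N. \<Sum>js\<in>exps k D.
          c * 2 ^ D * prod_list (map2 (\<lambda>f n. f n) fs ns) * prod_list (map (g q \<mu>) js))"
        unfolding M_def
      proof (intro sum.cong refl)
        fix ns js assume ns: "ns \<in> exps (length pre + R) N" and js: "js \<in> exps k D"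
        have len: "length ns = length pre + R" using ns by (simp add: exps_def)
        show "W js ns * (2 ^ D * Z ns) = c * 2 ^ D * prod_list (map2 (\<lambda>f n. f n) fs ns) * prod_list (map (g q \<mu>) js)"
          unfolding W[OF ns js] fs_def zip_weights_eq[OF len, symmetric] Z_def by (simp only: ac_simps)
      qed
      also have "\<dots> = c * 2 ^ D * conv fs N * (\<Sum>js\<in>exps k D. prod_list (map (g q \<mu>) js))"
        by (simp add: conv_def fs_def sum_distrib_left sum_distrib_right mult.assoc) (rule sum.swap)
      also have "(2 * real D + 1 / (1 - q)) * \<dots> \<le> (2 * real D + 1 / (1 - q)) * (c * 2 ^ D * conv fs N * (inverse (t ^ D) * B ^ k))"
        unfolding B_def
        using c q by (intro mult_left_mono sum_g_le[OF t] mult_nonneg_nonneg conv_nonneg add_nonneg_nonneg)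
          (auto simp: fs_def intro!: mult_nonneg_nonneg less_imp_le[OF x_weight_pos] split: if_splits)
      finally show ?thesis by (simp add: P_def C0_def ac_simps)
    qed
    have "(\<lambda>N. conv fs N * y ^ N) sums (\<Prod>f\<leftarrow>fs. \<Sum>n. f n * y ^ n)"
    proof (rule conv_sums)
      fix f assume "f \<in> set fs"
      then consider a where "f = x_weight q \<mu> a" | "f = (\<lambda>n. x_weight q \<mu> 0 n * q ^ n)"
        by (auto simp: fs_def split: if_splits)
      note f = this
      show "0 \<le> f n" for n
        using q by (rule_tac f) (auto intro: less_imp_le[OF x_weight_pos] intro!: mult_nonneg_nonneg)
      show "summable (\<lambda>n. f n * y ^ n)"
      proof (rule f)
        assume "f = (\<lambda>n. x_weight q \<mu> 0 n * q ^ n)"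
        moreover have "summable (\<lambda>n. x_weight q \<mu> 0 n * (q * y) ^ n)"
          using q y mult_strict_mono[of q 1 y 1] by (intro summable_x_series) (simp add: abs_mult)
        ultimately show ?thesis by (simp add: power_mult_distrib mult.assoc)
      qed (use summable_x_series y in auto)
    qed (use y in simp)
    also have "(\<Prod>f\<leftarrow>fs. \<Sum>n. f n * y ^ n) = (\<Prod>a\<leftarrow>pre. x_series q \<mu> a y) * K1 ^ R"
      by (simp add: fs_def prod_list_replicate o_def x_series_def K1_def power_mult_distrib ac_simps)
    finally have "e sums (C0 * B ^ k * ((\<Prod>a\<leftarrow>pre. x_series q \<mu> a y) * K1 ^ R))"
      unfolding e_def by (rule sums_mult)
    also have "C0 * B ^ k * ((\<Prod>a\<leftarrow>pre. x_series q \<mu> a y) * K1 ^ R) = C * (B * K1) ^ R"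
      by (simp add: C_def k_def power_add power_mult_distrib ac_simps)
    finally have "e sums (C * (B * K1) ^ R)" .
    moreover have "\<bar>y ^ N * k_trace q (XA_poly q \<mu> xs (pre @ replicate R 0) N) -
        y ^ N * poly (XA_poly q \<mu> xs (pre @ replicate R 0) N) 1\<bar> \<le> e N" for N
      using mult_left_mono[OF bound[of N], of "y ^ N"] y
      by (simp add: e_def abs_mult ac_simps flip: right_diff_distrib)
    ultimately show ?thesis by blast
  qed
  ultimately show ?thesis unfolding B_def K1_def by blast
qed

lemma Tr_series_bound:
  assumes "0 < q" "q < 1"
    and e: "\<And>N. \<bar>y ^ N * k_trace q (XA_poly q \<mu> xs ds N) - y ^ N * poly (XA_poly q \<mu> xs ds N) 1\<bar> \<le> e N" "e sums E"
    and S: "(\<lambda>N. y ^ N * poly (XA_poly q \<mu> xs ds N) 1) sums S"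
  shows "summable (Tr_series q \<mu> y xs ds) \<and> (\<exists>T. Tr' q \<mu> y xs ds = of_real T \<and> \<bar>T - S\<bar> \<le> E)"
proof -
  define d where "d N = y ^ N * k_trace q (XA_poly q \<mu> xs ds N) - y ^ N * poly (XA_poly q \<mu> xs ds N) 1" for N
  have abs: "summable (\<lambda>N. \<bar>d N\<bar>)"
    by (rule summable_comparison_test'[of e 0]) (use e in \<open>auto simp: d_def sums_iff\<close>)
  then have d: "summable d" by (rule summable_rabs_cancel)
  have "\<bar>suminf d\<bar> \<le> (\<Sum>N. \<bar>d N\<bar>)" by (rule summable_rabs[OF abs])
  also have "\<dots> \<le> E" using suminf_le[OF _ abs, of e] e by (auto simp: d_def sums_iff)
  finally have le: "\<bar>suminf d\<bar> \<le> E" .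
  have "(\<lambda>N. d N + y ^ N * poly (XA_poly q \<mu> xs ds N) 1) sums (suminf d + S)"
    by (intro sums_add S summable_sums d)
  then have "(\<lambda>N. y ^ N * k_trace q (XA_poly q \<mu> xs ds N)) sums (suminf d + S)"
    by (simp add: d_def)
  then have "Tr_series q \<mu> y xs ds sums of_real (suminf d + S)"
    unfolding Tr_series_eq[OF assms(1,2), abs_def] by (rule sums_of_real)
  then show ?thesis using le unfolding Tr'_def by (auto simp: sums_iff intro!: exI[of _ "suminf d + S"])
qed

text \<open>The matrix elements <l| X(a_1, n_1) ... X(a_m, n_m) |0>, and below those of the products of A(d).\<close>

definition vac_amp :: "real \<Rightarrow> real \<Rightarrow> (nat \<times> nat) list \<Rightarrow> nat \<Rightarrow> real" where
  "vac_amp q \<mu> xs l = (\<Sum>js\<in>exps (length xs) (l + sum_list (map fst xs)).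
     path_weight q \<mu> js xs * poly (path_poly q (zip js xs)) 1)"

lemma vac_amp_Nil: "vac_amp q \<mu> [] l = (if l = 0 then 1 else 0)"
  by (simp add: vac_amp_def exps_0 path_weight_def)

text \<open>The leftmost operator acts on <l|: b^j k^n c^a turns it into a multiple of <l - j + a|,
  and <l| b^j = 0 for j > l cuts the sum off at l.\<close>

lemma vac_amp_Cons:
  assumes q: "q \<noteq> 0"
  shows "vac_amp q \<mu> ((a, n) # xs) l =
    (\<Sum>j\<le>l. x_coeff q \<mu> j (a, n) * ((q ^ (l - j)) ^ n * lowering q a (l - j + a)) * vac_amp q \<mu> xs (l - j + a))"
proof -
  define s where "s = sum_list (map fst xs)"
  define F where "F j = (\<Sum>js\<in>exps (length xs) (l + (a + s) - j).
      path_weight q \<mu> (j # js) ((a, n) # xs) * poly (path_poly q ((j, a, n) # zip js xs)) 1)" for j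
  have "vac_amp q \<mu> ((a, n) # xs) l = (\<Sum>j\<le>l + (a + s). F j)"
    by (simp add: vac_amp_def sum_exps_Suc F_def s_def del: path_poly.simps)
  also have "\<dots> = (\<Sum>j\<le>l. F j)"
  proof (rule sum.mono_neutral_right)
    show "\<forall>j\<in>{..l + (a + s)} - {..l}. F j = 0"
      unfolding F_def
    proof (intro ballI sum.neutral)
      fix j js assume j: "j \<in> {..l + (a + s)} - {..l}" and js: "js \<in> exps (length xs) (l + (a + s) - j)"
      have "shift (zip js xs) = int l + int a - int j"
        using js j by (subst shift_zip) (auto simp: exps_def s_def)
      then have "poly (path_poly q ((j, a, n) # zip js xs)) (q ^ 0) = 0"
        using j by (intro path_poly_eq_0[OF q] path_poly_vanishes[OF q]) auto
      then show "path_weight q \<mu> (j # js) ((a, n) # xs) * poly (path_poly q ((j, a, n) # zip js xs)) 1 = 0"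
        by (simp del: path_poly.simps)
    qed
  qed auto
  also have "\<dots> = (\<Sum>j\<le>l. x_coeff q \<mu> j (a, n) * ((q ^ (l - j)) ^ n * lowering q a (l - j + a)) * vac_amp q \<mu> xs (l - j + a))"
  proof (rule sum.cong[OF refl])
    fix j assume "j \<in> {..l}"
    then have j: "j \<le> l" by simp
    then have ind: "l + (a + s) - j = l - j + a + s" by simp
    show "F j = x_coeff q \<mu> j (a, n) * ((q ^ (l - j)) ^ n * lowering q a (l - j + a)) * vac_amp q \<mu> xs (l - j + a)"
      unfolding F_def vac_amp_def ind s_def[symmetric] sum_distrib_left
    proof (rule sum.cong[OF refl])
      fix js assume js: "js \<in> exps (length xs) (l - j + a + s)"
      have "shift (zip js xs) = int (l - j) + int a"
        using js j by (subst shift_zip) (auto simp: exps_def s_def)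
      then have "poly (path_poly q ((j, a, n) # zip js xs)) (q ^ 0) =
        poly (path_poly q (zip js xs)) (q ^ 0) * ((q ^ (l - j)) ^ n * lowering q a (l - j + a))"
        by (intro poly_path_poly_Cons_nat[OF q]) simp
      then show "path_weight q \<mu> (j # js) ((a, n) # xs) * poly (path_poly q ((j, a, n) # zip js xs)) 1 =
        x_coeff q \<mu> j (a, n) * ((q ^ (l - j)) ^ n * lowering q a (l - j + a)) *
          (path_weight q \<mu> js xs * poly (path_poly q (zip js xs)) 1)"
        by (simp add: path_weight_def ac_simps del: path_poly.simps)
    qed
  qed
  finally show ?thesis .
qed

definition vac_amp_coeff :: "real \<Rightarrow> real \<Rightarrow> nat list \<Rightarrow> nat \<Rightarrow> nat \<Rightarrow> real" where
  "vac_amp_coeff q \<mu> ds l N = (\<Sum>ns\<in>exps (length ds) N. vac_amp q \<mu> (zip ds ns) l)"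

lemma poly_XA_poly_1:
  "poly (XA_poly q \<mu> xs ds N) 1 = (\<Sum>ns\<in>exps (length ds) N. vac_amp q \<mu> (xs @ zip ds ns) 0)"
  unfolding XA_poly_def poly_sum vac_amp_def
  by (rule sum.cong) (auto simp: exps_def)

text \<open><0| b = 0 leaves only the term j = 0, and <0| k = <0| makes k^n invisible.\<close>

lemma (in q_params) poly_XA_poly_single:
  "poly (XA_poly q \<mu> [(0, n)] ds N) 1 = g q \<mu> n * vac_amp_coeff q \<mu> ds 0 N"
  unfolding poly_XA_poly_1 vac_amp_coeff_def using q
  by (simp add: vac_amp_Cons lowering_def x_coeff_eq x_weight_0 sum_distrib_left)

text \<open>The powers of y are distributed so that the inner sum is a Cauchy product; k^n acting on
  <l - j| turns y into y q^(l - j).\<close>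

lemma vac_amp_coeff_Cons:
  assumes "q \<noteq> 0"
  shows "vac_amp_coeff q \<mu> (d # ds) l N * y ^ N = (\<Sum>j\<le>l. g q \<mu> j * lowering q d (l - j + d) *
     (\<Sum>n\<le>N. (x_weight q \<mu> d n * (y * q ^ (l - j)) ^ n) * (vac_amp_coeff q \<mu> ds (l - j + d) (N - n) * y ^ (N - n))))"
proof -
  have "vac_amp_coeff q \<mu> (d # ds) l N * y ^ N =
    (\<Sum>n\<le>N. \<Sum>j\<le>l. (x_coeff q \<mu> j (d, n) * ((q ^ (l - j)) ^ n * lowering q d (l - j + d)) *
       vac_amp_coeff q \<mu> ds (l - j + d) (N - n)) * y ^ N)"
    unfolding vac_amp_coeff_def
    by (simp add: sum_exps_Suc vac_amp_Cons[OF assms] sum_distrib_left sum_distrib_right) (subst sum.swap, simp)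
  also have "\<dots> = (\<Sum>j\<le>l. \<Sum>n\<le>N. (x_coeff q \<mu> j (d, n) * ((q ^ (l - j)) ^ n * lowering q d (l - j + d)) *
       vac_amp_coeff q \<mu> ds (l - j + d) (N - n)) * y ^ N)"
    by (rule sum.swap)
  also have "\<dots> = (\<Sum>j\<le>l. g q \<mu> j * lowering q d (l - j + d) *
     (\<Sum>n\<le>N. (x_weight q \<mu> d n * (y * q ^ (l - j)) ^ n) * (vac_amp_coeff q \<mu> ds (l - j + d) (N - n) * y ^ (N - n))))"
    unfolding sum_distrib_left
  proof (intro sum.cong refl)
    fix j n assume "n \<in> {..N}"
    then have "y ^ N = y ^ n * y ^ (N - n)" by (simp flip: power_add)
    then show "(x_coeff q \<mu> j (d, n) * ((q ^ (l - j)) ^ n * lowering q d (l - j + d)) *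
       vac_amp_coeff q \<mu> ds (l - j + d) (N - n)) * y ^ N = g q \<mu> j * lowering q d (l - j + d) *
     ((x_weight q \<mu> d n * (y * q ^ (l - j)) ^ n) * (vac_amp_coeff q \<mu> ds (l - j + d) (N - n) * y ^ (N - n)))"
      by (simp add: x_coeff_eq power_mult_distrib ac_simps)
  qed
  finally show ?thesis .
qed

text \<open>The matrix elements <l| A(d_1) ... A(d_s) |0> with the sum over the powers of y carried
  out. Defining them by their recursion confines convergence to
  \<open>vac_amp_coeff_sums\<close>.\<close>

primrec vac_series :: "real \<Rightarrow> real \<Rightarrow> real \<Rightarrow> nat list \<Rightarrow> nat \<Rightarrow> real" where
  "vac_series q \<mu> y [] l = (if l = 0 then 1 else 0)"
| "vac_series q \<mu> y (d # ds) l = (\<Sum>j\<le>l. g q \<mu> j * lowering q d (l - j + d) *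
     (x_series q \<mu> d (y * q ^ (l - j)) * vac_series q \<mu> y ds (l - j + d)))"

context q_params
begin

lemma y_q_power: "0 < y * q ^ i" "y * q ^ i < 1"
proof -
  have "y * q ^ i \<le> y" using q y by (intro mult_left_le) (auto simp: power_le_one)
  then show "y * q ^ i < 1" using y by (rule_tac order_le_less_trans)
qed (use q y in simp)

lemma vac_amp_nonneg: "0 \<le> vac_amp q \<mu> xs l"
proof (induction xs arbitrary: l)
  case (Cons x xs)
  obtain a n where x: "x = (a, n)" by (cases x)
  show ?case unfolding x using q Cons
    by (subst vac_amp_Cons)
      (auto simp: x_coeff_eq intro!: sum_nonneg mult_nonneg_nonneg less_imp_le[OF x_weight_pos]
         less_imp_le[OF g_pos] less_imp_le[OF lowering_pos])
qed (simp add: vac_amp_Nil)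

lemma vac_amp_coeff_sums: "(\<lambda>N. vac_amp_coeff q \<mu> ds l N * y ^ N) sums vac_series q \<mu> y ds l"
proof (induction ds arbitrary: l)
  case Nil
  have "(\<lambda>N. vac_amp_coeff q \<mu> [] l N * y ^ N) = (\<lambda>N. if N = 0 then (if l = 0 then 1 else 0) else 0)"
    by (auto simp: vac_amp_coeff_def exps_0 vac_amp_Nil)
  then show ?case using sums_single[of 0 "\<lambda>_. if l = 0 then 1 else 0::real"] by simp
next
  case (Cons d ds)
  \<comment> \<open>Nonnegative terms make the convergence absolute, as the Cauchy product
    requires.\<close>
  have nonneg: "0 \<le> vac_amp_coeff q \<mu> ds l N * y ^ N" for l N
    unfolding vac_amp_coeff_def using y by (intro mult_nonneg_nonneg sum_nonneg vac_amp_nonneg) auto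
  have "(\<lambda>N. \<Sum>n\<le>N. (x_weight q \<mu> d n * (y * q ^ i) ^ n) * (vac_amp_coeff q \<mu> ds l' (N - n) * y ^ (N - n))) sums
      (x_series q \<mu> d (y * q ^ i) * vac_series q \<mu> y ds l')" for i l'
  proof -
    have s: "(\<lambda>n. x_weight q \<mu> d n * (y * q ^ i) ^ n) sums x_series q \<mu> d (y * q ^ i)"
      using y_q_power[of i] by (intro x_series_sums) auto
    have "0 \<le> x_weight q \<mu> d n * (y * q ^ i) ^ n" for n
      using y_q_power[of i] x_weight_pos[of d n] by simp
    then show ?thesis
      using Cauchy_product_sums[of "\<lambda>n. x_weight q \<mu> d n * (y * q ^ i) ^ n" "\<lambda>N. vac_amp_coeff q \<mu> ds l' N * y ^ N"]
        s Cons[of l'] nonneg[of l'] by (simp only: sums_iff real_norm_def abs_of_nonneg)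
  qed
  then show ?case
    using q unfolding vac_series.simps by (subst vac_amp_coeff_Cons) (auto intro!: sums_sum sums_mult)
qed

end

subsection \<open>Large rings\<close>

text \<open>B / (1 - \<kappa>) is the fixed point of the limiting recursion. The distance from it is
  contracted by \<kappa> in each step, up to the perturbation b n - B, which tends to 0.\<close>

lemma tendsto_affine_recursion:
  fixes x b :: "nat \<Rightarrow> real"
  assumes \<kappa>: "0 \<le> \<kappa>" "\<kappa> < 1" and b: "b \<longlonglongrightarrow> B" and x: "\<And>n. x (Suc n) = \<kappa> * x n + b n"
  shows "x \<longlonglongrightarrow> B / (1 - \<kappa>)"
proof (rule LIMSEQ_I)
  fix r :: real assume r: "0 < r"
  define z where "z n = x n - B / (1 - \<kappa>)" for n
  have z: "z (Suc n) = \<kappa> * z n + (b n - B)" for n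
    using \<kappa> by (simp add: z_def x field_simps)
  \<comment> \<open>Chosen so that \<kappa> r/2 + e = r/2, which makes the bound on z reproduce
    itself.\<close>
  define e where "e = r * (1 - \<kappa>) / 2"
  have "0 < e" using r \<kappa> by (simp add: e_def)
  then obtain N where N: "\<bar>b n - B\<bar> < e" if "n \<ge> N" for n
    using LIMSEQ_D[OF b] by auto
  have *: "\<bar>z (N + k)\<bar> \<le> \<kappa> ^ k * \<bar>z N\<bar> + r / 2" for k
  proof (induction k)
    case (Suc k)
    have "\<bar>z (N + Suc k)\<bar> \<le> \<kappa> * \<bar>z (N + k)\<bar> + \<bar>b (N + k) - B\<bar>"
      using abs_triangle_ineq[of "\<kappa> * z (N + k)" "b (N + k) - B"] \<kappa> by (simp add: z abs_mult)
    also have "\<dots> \<le> \<kappa> * (\<kappa> ^ k * \<bar>z N\<bar> + r / 2) + e"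
      using Suc N[of "N + k"] \<kappa> by (intro add_mono mult_left_mono) auto
    also have "\<dots> = \<kappa> ^ Suc k * \<bar>z N\<bar> + r / 2" by (simp add: e_def field_simps)
    finally show ?case .
  qed (use r in simp)
  have "(\<lambda>k. \<kappa> ^ k * \<bar>z N\<bar>) \<longlonglongrightarrow> 0 * \<bar>z N\<bar>"
    by (intro tendsto_mult LIMSEQ_realpow_zero tendsto_const) (use \<kappa> in auto)
  then have "\<forall>\<^sub>F k in sequentially. \<kappa> ^ k * \<bar>z N\<bar> < r / 2"
    using r by (intro order_tendstoD(2)) auto
  then obtain k0 where k0: "\<kappa> ^ k * \<bar>z N\<bar> < r / 2" if "k \<ge> k0" for k
    by (auto simp: eventually_sequentially)
  have "norm (x n - B / (1 - \<kappa>)) < r" if "n \<ge> N + k0" for n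
  proof -
    have "\<kappa> ^ (n - N) * \<bar>z N\<bar> < r / 2" using that by (intro k0) simp
    then show ?thesis using *[of "n - N"] that by (simp add: z_def)
  qed
  then show "\<exists>no. \<forall>n\<ge>no. norm (x n - B / (1 - \<kappa>)) < r" by blast
qed

context q_params
begin

lemma x_series_q_power_less: "0 < i \<Longrightarrow> x_series q \<mu> 0 (y * q ^ i) < x_series q \<mu> 0 y"
  using y_q_power[of i] q y by (intro x_series_less) (auto simp: power_less_one_iff)

lemma x_series_y_pos: "0 < x_series q \<mu> 0 y"
  using y by (intro x_series_pos) auto

lemma lowering_0 [simp]: "lowering q 0 m = 1"
  by (simp add: lowering_def)

text \<open>
  Acting on the row vector <l|, A_0 is triangular with diagonal entries K(y q^l) in decreasing
  order, where K = x_series q mu 0. So the powers of A_0 / K(y) converge.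
\<close>

lemma vac_series_replicate_limit:
  "\<exists>c>0. (\<lambda>R. vac_series q \<mu> y (replicate R 0) l / x_series q \<mu> 0 y ^ R) \<longlonglongrightarrow> c"
proof (induction l rule: less_induct)
  case (less l)
  define K where "K = x_series q \<mu> 0 y"
  define a where "a l R = vac_series q \<mu> y (replicate R 0) l / K ^ R" for l R
  define \<kappa> where "\<kappa> i = x_series q \<mu> 0 (y * q ^ i) / K" for i
  have K: "0 < K" unfolding K_def by (rule x_series_y_pos)
  have \<kappa>: "0 < \<kappa> i" for i using x_series_pos[of "y * q ^ i" 0] y_q_power[of i] K by (simp add: \<kappa>_def)
  have rec: "a l (Suc R) = (\<Sum>j\<le>l. g q \<mu> j * \<kappa> (l - j) * a (l - j) R)" for R l
    using K by (simp add: a_def \<kappa>_def sum_divide_distrib ac_simps)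
  show ?case
  proof (cases "l = 0")
    case True
    have "a 0 R = 1" for R
    proof (induction R)
      case (Suc R)
      then show ?case using K by (simp add: rec) (simp add: \<kappa>_def K_def)
    qed (simp add: a_def)
    then have "(\<lambda>R. a 0 R) \<longlonglongrightarrow> 1" by simp
    then show ?thesis unfolding True a_def K_def using zero_less_one by blast
  next
    case False
    have "\<forall>i. \<exists>c. i < l \<longrightarrow> 0 < c \<and> (\<lambda>R. a i R) \<longlonglongrightarrow> c"
      using less by (auto simp: a_def K_def)
    then obtain c where c: "0 < c i" "(\<lambda>R. a i R) \<longlonglongrightarrow> c i" if "i < l" for i
      by metis
    \<comment> \<open>The term j = 0 of the recursion is the diagonal one, with \<kappa> l < 1. The
      terms j >= 1 collected here involve smaller l and converge to positive limits by
      induction.\<close>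
    define b where "b R = (\<Sum>j=1..l. g q \<mu> j * \<kappa> (l - j) * a (l - j) R)" for R
    define B where "B = (\<Sum>j=1..l. g q \<mu> j * \<kappa> (l - j) * c (l - j))"
    have "b \<longlonglongrightarrow> B" unfolding b_def B_def by (intro tendsto_intros c) auto
    moreover have "a l (Suc R) = \<kappa> l * a l R + b R" for R
      by (simp add: rec b_def atMost_atLeast0 sum.atLeast_Suc_atMost)
    moreover have "\<kappa> l < 1" using x_series_q_power_less[of l] False K by (simp add: \<kappa>_def K_def)
    ultimately have "(\<lambda>R. a l R) \<longlonglongrightarrow> B / (1 - \<kappa> l)"
      using \<kappa>[of l] by (intro tendsto_affine_recursion[of _ b]) auto
    moreover have "0 < B" unfolding B_def
      using False c(1) \<kappa> g_pos by (intro sum_pos) auto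
    then have "0 < B / (1 - \<kappa> l)" using \<open>\<kappa> l < 1\<close> by simp
    ultimately show ?thesis unfolding a_def K_def by blast
  qed
qed

text \<open>Each A(d) turns <l| into a finite combination of the <l - j + d| with positive
  coefficients, so positivity of the limits survives. At l = 0 it keeps the limit of the normalised
  denominator of \<open>P_ring\<close> away from 0.\<close>

lemma vac_series_limit:
  "\<exists>c>0. (\<lambda>R. vac_series q \<mu> y (ds @ replicate R 0) l / x_series q \<mu> 0 y ^ R) \<longlonglongrightarrow> c"
proof (induction ds arbitrary: l)
  case Nil
  then show ?case using vac_series_replicate_limit by simp
next
  case (Cons d ds)
  define K where "K = x_series q \<mu> 0 y"
  obtain c where c: "0 < c l" "(\<lambda>R. vac_series q \<mu> y (ds @ replicate R 0) l / K ^ R) \<longlonglongrightarrow> c l" for l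
    using Cons unfolding K_def by metis
  define w where "w j = g q \<mu> j * lowering q d (l - j + d) * x_series q \<mu> d (y * q ^ (l - j))" for j
  have "(\<lambda>R. \<Sum>j\<le>l. w j * (vac_series q \<mu> y (ds @ replicate R 0) (l - j + d) / K ^ R)) \<longlonglongrightarrow>
      (\<Sum>j\<le>l. w j * c (l - j + d))"
    by (intro tendsto_intros c)
  moreover have "vac_series q \<mu> y ((d # ds) @ replicate R 0) l / K ^ R =
      (\<Sum>j\<le>l. w j * (vac_series q \<mu> y (ds @ replicate R 0) (l - j + d) / K ^ R))" for R
    by (simp add: w_def sum_divide_distrib ac_simps)
  moreover have "0 < w j" for j
    unfolding w_def using g_pos lowering_pos[OF q] y_q_power
    by (intro mult_pos_pos x_series_pos) (auto intro: less_imp_le)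
  then have "0 < (\<Sum>j\<le>l. w j * c (l - j + d))" using c(1) by (intro sum_pos) auto
  ultimately show ?case unfolding K_def by auto
qed

lemma vac_series_replicate_append:
  "vac_series q \<mu> y (replicate r 0 @ ds) 0 = x_series q \<mu> 0 y ^ r * vac_series q \<mu> y ds 0"
  by (induction r) (auto simp: ac_simps)

lemma poly_XA_poly_Nil_sums:
  "(\<lambda>N. y ^ N * poly (XA_poly q \<mu> [] ds N) 1) sums vac_series q \<mu> y ds 0"
  using vac_amp_coeff_sums[of ds 0] by (simp add: poly_XA_poly_1 vac_amp_coeff_def mult.commute)

lemma poly_XA_poly_single_sums:
  "(\<lambda>N. y ^ N * poly (XA_poly q \<mu> [(0, n)] ds N) 1) sums (g q \<mu> n * vac_series q \<mu> y ds 0)"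
  using sums_mult[OF vac_amp_coeff_sums[of ds 0], of "g q \<mu> n"]
  by (simp add: poly_XA_poly_single ac_simps)

text \<open>K(t) tends to K(0) = g_0 = 1 as t tends to 0, and K(y q) < K(y).\<close>

lemma ratio_parameter:
  "\<exists>t. 0 < t \<and> t < 1 \<and> x_series q \<mu> 0 t * x_series q \<mu> 0 (y * q) < x_series q \<mu> 0 y"
proof -
  have "((\<lambda>t. x_series q \<mu> 0 t * x_series q \<mu> 0 (y * q)) \<longlongrightarrow> x_weight q \<mu> 0 0 * x_series q \<mu> 0 (y * q)) (at 0)"
    by (intro tendsto_intros x_series_tendsto_0)
  then have "((\<lambda>t. x_series q \<mu> 0 t * x_series q \<mu> 0 (y * q)) \<longlongrightarrow> x_series q \<mu> 0 (y * q)) (at_right 0)"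
    by (simp add: x_weight_0 filterlim_at_split)
  then have "\<forall>\<^sub>F t in at_right 0. x_series q \<mu> 0 t * x_series q \<mu> 0 (y * q) < x_series q \<mu> 0 y"
    using x_series_q_power_less[of 1] by (intro order_tendstoD) auto
  moreover have "\<forall>\<^sub>F t in at_right (0::real). t \<in> {0<..<1}"
    by (rule eventually_at_right_real) simp
  ultimately have "\<forall>\<^sub>F t in at_right 0. 0 < t \<and> t < 1 \<and> x_series q \<mu> 0 t * x_series q \<mu> 0 (y * q) < x_series q \<mu> 0 y"
    by eventually_elim auto
  then show ?thesis by (rule eventually_happens'[rotated]) simp
qed

text \<open>w stands for the eigenvalue of <0| under the factors \<open>xs\<close>: 1 for the empty
  list, g_n for [(0, n)]. One statement thus serves denominator and numerator. After normalisation
  the deviation from the vacuum part is O((\<rho>/K)^R).\<close>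

lemma Tr'_asymptotics:
  assumes D: "1 \<le> sum_list (map fst xs) + sum_list pre"
    and S: "\<And>R. (\<lambda>N. y ^ N * poly (XA_poly q \<mu> xs (pre @ replicate R 0) N) 1) sums
      (w * vac_series q \<mu> y (pre @ replicate R 0) 0)"
    and c: "(\<lambda>R. vac_series q \<mu> y (pre @ replicate R 0) 0 / x_series q \<mu> 0 y ^ R) \<longlonglongrightarrow> c"
  shows "summable (Tr_series q \<mu> y xs (pre @ replicate R 0))"
    and "(\<lambda>R. Tr' q \<mu> y xs (pre @ replicate R 0) / of_real (x_series q \<mu> 0 y ^ R)) \<longlonglongrightarrow> of_real (w * c)"
proof -
  define K where "K = x_series q \<mu> 0 y"
  define v where "v R = w * vac_series q \<mu> y (pre @ replicate R 0) 0" for R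
  obtain t where t: "0 < t" "t < 1" "x_series q \<mu> 0 t * x_series q \<mu> 0 (y * q) < K"
    using ratio_parameter unfolding K_def by blast
  define \<rho> where "\<rho> = x_series q \<mu> 0 t * x_series q \<mu> 0 (y * q)"
  have \<rho>: "0 \<le> \<rho>" "\<rho> < K" unfolding \<rho>_def
    using t q y y_q_power[of 1] by (auto intro!: mult_nonneg_nonneg less_imp_le[OF x_series_pos])
  have K: "0 < K" unfolding K_def by (rule x_series_y_pos)
  obtain C where C: "\<exists>e. (\<forall>N. \<bar>y ^ N * k_trace q (XA_poly q \<mu> xs (pre @ replicate R 0) N) -
        y ^ N * poly (XA_poly q \<mu> xs (pre @ replicate R 0) N) 1\<bar> \<le> e N) \<and> e sums (C * \<rho> ^ R)" for R
    using k_trace_XA_poly_bound[OF D t(1,2)] unfolding \<rho>_def by blast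
  have bound: "summable (Tr_series q \<mu> y xs (pre @ replicate R 0)) \<and>
      (\<exists>T. Tr' q \<mu> y xs (pre @ replicate R 0) = of_real T \<and> \<bar>T - v R\<bar> \<le> C * \<rho> ^ R)" for R
    using C[of R] Tr_series_bound[OF q _ _ S[of R]] unfolding v_def by blast
  then show "summable (Tr_series q \<mu> y xs (pre @ replicate R 0))" by blast
  obtain T where T: "Tr' q \<mu> y xs (pre @ replicate R 0) = of_real (T R)" "\<bar>T R - v R\<bar> \<le> C * \<rho> ^ R" for R
    using bound by metis
  have "(\<lambda>R. C * (\<rho> / K) ^ R) \<longlonglongrightarrow> C * 0"
    by (intro tendsto_mult tendsto_const LIMSEQ_realpow_zero) (use \<rho> K in auto)
  then have lim0: "(\<lambda>R. C * (\<rho> / K) ^ R) \<longlonglongrightarrow> 0" by simp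
  have "\<bar>(T R - v R) / K ^ R\<bar> \<le> C * (\<rho> / K) ^ R" for R
    using divide_right_mono[OF T(2)[of R], of "K ^ R"] K by (simp add: power_divide)
  then have "(\<lambda>R. (T R - v R) / K ^ R) \<longlonglongrightarrow> 0"
    by (intro Lim_null_comparison[OF _ lim0]) simp
  moreover have "(\<lambda>R. w * (vac_series q \<mu> y (pre @ replicate R 0) 0 / K ^ R)) \<longlonglongrightarrow> w * c"
    unfolding K_def by (intro tendsto_intros c)
  ultimately have "(\<lambda>R. (T R - v R) / K ^ R + w * (vac_series q \<mu> y (pre @ replicate R 0) 0 / K ^ R)) \<longlonglongrightarrow> 0 + w * c"
    by (rule tendsto_add)
  then have "(\<lambda>R. T R / K ^ R) \<longlonglongrightarrow> w * c"
    by (simp add: v_def diff_divide_distrib)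
  then have "(\<lambda>R. of_real (T R / K ^ R)) \<longlonglongrightarrow> complex_of_real (w * c)"
    by (rule tendsto_of_real)
  then show "(\<lambda>R. Tr' q \<mu> y xs (pre @ replicate R 0) / of_real (x_series q \<mu> 0 y ^ R)) \<longlonglongrightarrow> of_real (w * c)"
    by (simp add: T K_def)
qed

lemma
  assumes ds: "1 \<le> sum_list ds"
  shows P_ring_tendsto: "P_ring q \<mu> y ds r n \<longlonglongrightarrow> of_real (y ^ n * g q \<mu> n / x_series q \<mu> 0 y)"
    and summable_num: "nat \<bar>r\<bar> + length ds < L \<Longrightarrow> summable (Tr_series q \<mu> y [(0, n)] (num_sites ds r L))"
    and summable_den: "nat \<bar>r\<bar> + length ds < L \<Longrightarrow> summable (Tr_series q \<mu> y [] (den_sites ds L))"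
proof -
  define K where "K = x_series q \<mu> 0 y"
  have K: "0 < K" unfolding K_def by (rule x_series_y_pos)
  define m where "m = nat \<bar>r\<bar>"
  obtain c where c: "0 < c" "(\<lambda>R. vac_series q \<mu> y (ds @ replicate R 0) 0 / x_series q \<mu> 0 y ^ R) \<longlonglongrightarrow> c"
    using vac_series_limit by blast
  \<comment> \<open>The m factors A_0 to the left of \<open>ds\<close> act on <0| as K^m.\<close>
  have c': "(\<lambda>R. vac_series q \<mu> y ((replicate m 0 @ ds) @ replicate R 0) 0 / x_series q \<mu> 0 y ^ R) \<longlonglongrightarrow> K ^ m * c"
    using tendsto_mult_left[OF c(2), of "K ^ m"]
    by (simp add: vac_series_replicate_append K_def ac_simps)
  have D': "1 \<le> sum_list (map fst [(0, n)]) + sum_list (replicate m 0 @ ds)"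
    using ds by (simp add: sum_list_replicate)
  have D: "1 \<le> sum_list (map fst []) + sum_list ds" using ds by simp
  note num = Tr'_asymptotics[OF D' poly_XA_poly_single_sums c']
  have S: "(\<lambda>N. y ^ N * poly (XA_poly q \<mu> [] (ds @ replicate R 0) N) 1) sums
      (1 * vac_series q \<mu> y (ds @ replicate R 0) 0)" for R
    using poly_XA_poly_Nil_sums by simp
  note den = Tr'_asymptotics[OF D S c(2)]
  show "summable (Tr_series q \<mu> y [(0, n)] (num_sites ds r L))"
    using num(1)[of "L - m - length ds - 1"] by (simp add: num_sites_def m_def)
  show "summable (Tr_series q \<mu> y [] (den_sites ds L))"
    using den(1) by (simp add: den_sites_def)
  \<comment> \<open>At equal L the denominator has m + 1 more final A_0's than the numerator, where
    m of the A_0's stand to the left of \<open>ds\<close> and one site carries X(0,n). So K^m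
    cancels and a single 1/K survives.\<close>
  have den': "(\<lambda>R. Tr' q \<mu> y [] (ds @ replicate (R + (m + 1)) 0) / of_real (K ^ (R + (m + 1)))) \<longlonglongrightarrow> of_real c"
    using LIMSEQ_ignore_initial_segment[OF den(2), of "m + 1"] unfolding K_def by simp
  have "(\<lambda>R. of_real (y ^ n / K ^ (m + 1)) *
      ((Tr' q \<mu> y [(0, n)] ((replicate m 0 @ ds) @ replicate R 0) / of_real (K ^ R)) /
       (Tr' q \<mu> y [] (ds @ replicate (R + (m + 1)) 0) / of_real (K ^ (R + (m + 1)))))) \<longlonglongrightarrow>
     of_real (y ^ n / K ^ (m + 1)) * (of_real (g q \<mu> n * (K ^ m * c)) / of_real c)"
    using num(2) c(1) unfolding K_def[symmetric] by (intro tendsto_intros den') auto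
  also have "of_real (y ^ n / K ^ (m + 1)) * (of_real (g q \<mu> n * (K ^ m * c)) / of_real c) =
     complex_of_real (y ^ n * g q \<mu> n / K)"
    using c(1) K by (simp add: field_simps flip: of_real_mult of_real_divide)
  also have "(\<lambda>R. of_real (y ^ n / K ^ (m + 1)) *
      ((Tr' q \<mu> y [(0, n)] ((replicate m 0 @ ds) @ replicate R 0) / of_real (K ^ R)) /
       (Tr' q \<mu> y [] (ds @ replicate (R + (m + 1)) 0) / of_real (K ^ (R + (m + 1)))))) =
     (\<lambda>R. P_ring q \<mu> y ds r n (R + (m + length ds + 1)))"
  proof
    fix R
    have sites: "num_sites ds r (R + (m + length ds + 1)) = (replicate m 0 @ ds) @ replicate R 0"
      "den_sites ds (R + (m + length ds + 1)) = ds @ replicate (R + (m + 1)) 0"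
      by (simp_all add: num_sites_def den_sites_def m_def)
    show "of_real (y ^ n / K ^ (m + 1)) *
      ((Tr' q \<mu> y [(0, n)] ((replicate m 0 @ ds) @ replicate R 0) / of_real (K ^ R)) /
       (Tr' q \<mu> y [] (ds @ replicate (R + (m + 1)) 0) / of_real (K ^ (R + (m + 1))))) =
      P_ring q \<mu> y ds r n (R + (m + length ds + 1))"
      unfolding P_ring_def sites using K by (simp add: power_add field_simps)
  qed
  finally show "P_ring q \<mu> y ds r n \<longlonglongrightarrow> of_real (y ^ n * g q \<mu> n / x_series q \<mu> 0 y)"
    unfolding K_def by (rule LIMSEQ_offset)
qed

end

subsection \<open>The q-binomial theorem, density and currents\<close>

lemma qpoch_tendsto_qpoch_inf:
  assumes q: "0 < q" "q < 1" and z: "0 \<le> z" "z < 1"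
  shows "qpoch q z \<longlonglongrightarrow> qpoch_inf q z" "0 < qpoch_inf q z"
proof -
  have pos: "0 < 1 - z * q ^ j" for j
  proof -
    have "z * q ^ j \<le> z" using q z by (intro mult_left_le) (auto simp: power_le_one)
    then show ?thesis using z by linarith
  qed
  have "summable (\<lambda>j. norm (1 - z * q ^ j - 1))"
    using q z by (simp add: abs_mult summable_mult)
  then have conv: "convergent_prod (\<lambda>j. 1 - z * q ^ j)"
    by (intro abs_convergent_prod_imp_convergent_prod summable_imp_abs_convergent_prod)
  then show "qpoch q z \<longlonglongrightarrow> qpoch_inf q z"
    unfolding qpoch_def[abs_def] qpoch_inf_def
    by (simp add: LIMSEQ_lessThan_iff_atMost convergent_prod_LIMSEQ)
  then have "0 \<le> qpoch_inf q z"
    by (rule LIMSEQ_le_const) (use pos in \<open>auto simp: qpoch_def less_imp_le intro!: prod_nonneg\<close>)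
  \<comment> \<open>A convergent infinite product vanishes only if one of its factors does.\<close>
  moreover have "qpoch_inf q z \<noteq> 0"
    unfolding qpoch_inf_def using convergent_prod_to_zero_iff[OF conv] convergent_prod_LIMSEQ[OF conv] pos
    by (metis less_irrefl)
  ultimately show "0 < qpoch_inf q z" by simp
qed

lemma qpoch_add: "qpoch q z (m + k) = qpoch q z m * qpoch q (z * q ^ m) k"
  by (induction k) (auto simp: qpoch_def power_add mult.assoc)

section \<open>The q-difference equation for K and its logarithmic derivative\<close>

context q_params
begin

text \<open>This is z K'(z), so its quotient by K is the logarithmic derivative of K, the mean
  particle number at fugacity z.\<close>

definition x_moment :: "real \<Rightarrow> real" where
  "x_moment z = (\<Sum>n. real n * x_weight q \<mu> 0 n * z ^ n)"

lemma x_moment_powser: "\<bar>z\<bar> < 1 \<Longrightarrow> summable (\<lambda>n. real n * x_weight q \<mu> 0 n * z ^ n)"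
proof -
  assume z: "\<bar>z\<bar> < 1"
  have "summable (\<lambda>n. diffs (x_weight q \<mu> 0) n * z ^ n)"
    by (rule termdiff_converges[of _ 1]) (use z summable_x_series in auto)
  then have "summable (\<lambda>n. z * (diffs (x_weight q \<mu> 0) n * z ^ n))" by (rule summable_mult)
  then have "summable (\<lambda>n. real (Suc n) * x_weight q \<mu> 0 (Suc n) * z ^ Suc n)"
    by (simp add: diffs_def ac_simps)
  then show "summable (\<lambda>n. real n * x_weight q \<mu> 0 n * z ^ n)"
    by (subst (asm) summable_Suc_iff)
qed

lemma x_moment_sums: "\<bar>z\<bar> < 1 \<Longrightarrow> (\<lambda>n. real n * x_weight q \<mu> 0 n * z ^ n) sums x_moment z"
  unfolding x_moment_def by (intro summable_sums x_moment_powser)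

lemma x_moment_tendsto_0: "(x_moment \<longlongrightarrow> 0) (at 0)"
  using powser_limit_0[of 1 "\<lambda>n. real n * x_weight q \<mu> 0 n"] x_moment_sums by simp

lemma x_weight_0_Suc: "x_weight q \<mu> 0 (Suc n) * (1 - q ^ Suc n) = x_weight q \<mu> 0 n * (1 - \<mu> * q ^ n)"
  using x_weight_Suc[of 0 n] by simp

text \<open>Passing to K(z) - K(z q) multiplies the n-th coefficient by 1 - q^n, which the recursion
  of the weights converts into a multiple of the coefficient of index n - 1.\<close>

lemma x_series_rec:
  assumes z: "\<bar>z\<bar> < 1" "\<bar>z * q\<bar> < 1"
  shows "(1 - z) * x_series q \<mu> 0 z = (1 - \<mu> * z) * x_series q \<mu> 0 (z * q)"
proof -
  let ?w = "x_weight q \<mu> 0"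
  have "(\<lambda>n. ?w n * z ^ n - ?w n * (z * q) ^ n) sums (x_series q \<mu> 0 z - x_series q \<mu> 0 (z * q))"
    by (intro sums_diff x_series_sums z)
  then have "(\<lambda>n. ?w (Suc n) * z ^ Suc n - ?w (Suc n) * (z * q) ^ Suc n) sums (x_series q \<mu> 0 z - x_series q \<mu> 0 (z * q))"
    by (subst sums_Suc_iff) simp
  also have "(\<lambda>n. ?w (Suc n) * z ^ Suc n - ?w (Suc n) * (z * q) ^ Suc n) =
      (\<lambda>n. z * (?w n * z ^ n) - \<mu> * z * (?w n * (z * q) ^ n))"
  proof
    fix n
    have "?w (Suc n) * z ^ Suc n - ?w (Suc n) * (z * q) ^ Suc n = (?w (Suc n) * (1 - q ^ Suc n)) * z ^ Suc n"
      unfolding power_mult_distrib by (simp add: algebra_simps)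
    also have "\<dots> = z * (?w n * z ^ n) - \<mu> * z * (?w n * (z * q) ^ n)"
      unfolding x_weight_0_Suc power_mult_distrib by (simp add: algebra_simps)
    finally show "?w (Suc n) * z ^ Suc n - ?w (Suc n) * (z * q) ^ Suc n =
      z * (?w n * z ^ n) - \<mu> * z * (?w n * (z * q) ^ n)" .
  qed
  finally have "(\<lambda>n. z * (?w n * z ^ n) - \<mu> * z * (?w n * (z * q) ^ n)) sums
    (x_series q \<mu> 0 z - x_series q \<mu> 0 (z * q))" .
  moreover have "(\<lambda>n. z * (?w n * z ^ n) - \<mu> * z * (?w n * (z * q) ^ n)) sums
      (z * x_series q \<mu> 0 z - \<mu> * z * x_series q \<mu> 0 (z * q))"
    by (intro sums_diff sums_mult x_series_sums z)
  ultimately have "x_series q \<mu> 0 z - x_series q \<mu> 0 (z * q) = z * x_series q \<mu> 0 z - \<mu> * z * x_series q \<mu> 0 (z * q)"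
    by (rule sums_unique2)
  then show ?thesis by (simp add: algebra_simps)
qed

text \<open>The Euler derivative z d/dz of \<open>x_series_rec\<close>, derived on the
  coefficients.\<close>

lemma x_moment_rec:
  assumes z: "\<bar>z\<bar> < 1" "\<bar>z * q\<bar> < 1"
  shows "x_moment z - x_moment (z * q) =
    z * (x_moment z + x_series q \<mu> 0 z) - \<mu> * z * (x_moment (z * q) + x_series q \<mu> 0 (z * q))"
proof -
  let ?w = "x_weight q \<mu> 0"
  have "(\<lambda>n. real n * ?w n * z ^ n - real n * ?w n * (z * q) ^ n) sums (x_moment z - x_moment (z * q))"
    by (intro sums_diff x_moment_sums z)
  then have "(\<lambda>n. real (Suc n) * ?w (Suc n) * z ^ Suc n - real (Suc n) * ?w (Suc n) * (z * q) ^ Suc n) sums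
      (x_moment z - x_moment (z * q))"
    by (subst sums_Suc_iff) simp
  also have "(\<lambda>n. real (Suc n) * ?w (Suc n) * z ^ Suc n - real (Suc n) * ?w (Suc n) * (z * q) ^ Suc n) =
      (\<lambda>n. z * (real n * ?w n * z ^ n + ?w n * z ^ n) - \<mu> * z * (real n * ?w n * (z * q) ^ n + ?w n * (z * q) ^ n))"
  proof
    fix n
    have "real (Suc n) * ?w (Suc n) * z ^ Suc n - real (Suc n) * ?w (Suc n) * (z * q) ^ Suc n =
      (?w (Suc n) * (1 - q ^ Suc n)) * (real (Suc n) * z ^ Suc n)"
      unfolding power_mult_distrib by (simp add: algebra_simps)
    also have "\<dots> = z * (real n * ?w n * z ^ n + ?w n * z ^ n) - \<mu> * z * (real n * ?w n * (z * q) ^ n + ?w n * (z * q) ^ n)"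
      unfolding x_weight_0_Suc power_mult_distrib by (simp add: algebra_simps)
    finally show "real (Suc n) * ?w (Suc n) * z ^ Suc n - real (Suc n) * ?w (Suc n) * (z * q) ^ Suc n =
      z * (real n * ?w n * z ^ n + ?w n * z ^ n) - \<mu> * z * (real n * ?w n * (z * q) ^ n + ?w n * (z * q) ^ n)" .
  qed
  finally have "(\<lambda>n. z * (real n * ?w n * z ^ n + ?w n * z ^ n) - \<mu> * z * (real n * ?w n * (z * q) ^ n + ?w n * (z * q) ^ n)) sums
    (x_moment z - x_moment (z * q))" .
  moreover have "(\<lambda>n. z * (real n * ?w n * z ^ n + ?w n * z ^ n) - \<mu> * z * (real n * ?w n * (z * q) ^ n + ?w n * (z * q) ^ n)) sums
      (z * (x_moment z + x_series q \<mu> 0 z) - \<mu> * z * (x_moment (z * q) + x_series q \<mu> 0 (z * q)))"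
    by (intro sums_diff sums_add sums_mult x_series_sums x_moment_sums z)
  ultimately show ?thesis by (rule sums_unique2)
qed

lemma filterlim_y_q_power: "filterlim (\<lambda>n. y * q ^ n) (at 0) sequentially"
proof -
  have "(\<lambda>n. y * q ^ n) \<longlonglongrightarrow> y * 0"
    by (intro tendsto_mult tendsto_const LIMSEQ_realpow_zero) (use q in auto)
  then show ?thesis using q y by (simp add: filterlim_at)
qed

lemma x_series_y_q_power_limit: "(\<lambda>n. x_series q \<mu> 0 (y * q ^ n)) \<longlonglongrightarrow> 1"
  using filterlim_compose[OF x_series_tendsto_0 filterlim_y_q_power, of 0] by (simp add: x_weight_0)

lemma y_q_power_Suc: "\<bar>y * q ^ n\<bar> < 1" "\<bar>y * q ^ n * q\<bar> < 1" "y * q ^ n * q = y * q ^ Suc n"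
  "0 < 1 - y * q ^ n" "0 < 1 - \<mu> * (y * q ^ n)"
proof -
  show e: "y * q ^ n * q = y * q ^ Suc n" by simp
  show "\<bar>y * q ^ n\<bar> < 1" "0 < 1 - y * q ^ n" using y_q_power[of n] by auto
  show "\<bar>y * q ^ n * q\<bar> < 1" unfolding e using y_q_power[of "Suc n"] by (simp del: power_Suc)
  have "\<mu> * (y * q ^ n) \<le> y * q ^ n" using mu y_q_power[of n] by (intro mult_left_le_one_le) auto
  then show "0 < 1 - \<mu> * (y * q ^ n)" using y_q_power[of n] by linarith
qed

text \<open>Iterating K(z) = (1 - \<mu> z)/(1 - z) K(z q) from z = y builds up the two products,
  while K(y q^n) tends to K(0) = 1.\<close>

lemma q_binomial: "x_series q \<mu> 0 y = qpoch_inf q (\<mu> * y) / qpoch_inf q y"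
proof -
  have "x_series q \<mu> 0 y * qpoch q y n = qpoch q (\<mu> * y) n * x_series q \<mu> 0 (y * q ^ n)" for n
  proof (induction n)
    case (Suc n)
    have "x_series q \<mu> 0 y * qpoch q y (Suc n) =
        qpoch q (\<mu> * y) n * ((1 - y * q ^ n) * x_series q \<mu> 0 (y * q ^ n))"
      using Suc by (simp add: qpoch_def mult.assoc[symmetric])
    also have "\<dots> = qpoch q (\<mu> * y) (Suc n) * x_series q \<mu> 0 (y * q ^ Suc n)"
      using x_series_rec[of "y * q ^ n"] y_q_power_Suc[of n] by (simp add: qpoch_def ac_simps)
    finally show ?case .
  qed (simp add: qpoch_def)
  moreover have "(\<lambda>n. x_series q \<mu> 0 y * qpoch q y n) \<longlonglongrightarrow> x_series q \<mu> 0 y * qpoch_inf q y"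
    by (intro tendsto_intros qpoch_tendsto_qpoch_inf q) (use y in auto)
  moreover have "(\<lambda>n. qpoch q (\<mu> * y) n * x_series q \<mu> 0 (y * q ^ n)) \<longlonglongrightarrow> qpoch_inf q (\<mu> * y) * 1"
    by (intro tendsto_mult x_series_y_q_power_limit qpoch_tendsto_qpoch_inf q)
      (use y mu mult_strict_mono[of \<mu> 1 y 1] in auto)
  ultimately have "x_series q \<mu> 0 y * qpoch_inf q y = qpoch_inf q (\<mu> * y) * 1"
    using LIMSEQ_unique by simp
  then show ?thesis
    using qpoch_tendsto_qpoch_inf(2)[OF q, of y] y by (simp add: field_simps)
qed

lemma P_free_eq: "P_free q \<mu> y n = y ^ n * g q \<mu> n / x_series q \<mu> 0 y"
  by (simp add: P_free_def q_binomial g_def)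

text \<open>Logarithmic differentiation of \<open>x_series_rec\<close>: with s(z) = z K'(z)/K(z),
  the difference s(z) - s(z q) is z/(1 - z) - \<mu> z/(1 - \<mu> z), the i-th term of the density
  series when z = y q^i. The series telescopes, as s(y q^i) tends to 0.\<close>

lemma rho_free_eq: "rho_free q \<mu> y = x_moment y / x_series q \<mu> 0 y"
proof -
  define u where "u i = (1 - \<mu>) * y * q ^ i / ((1 - y * q ^ i) * (1 - \<mu> * y * q ^ i))" for i
  define s where "s i = x_moment (y * q ^ i) / x_series q \<mu> 0 (y * q ^ i)" for i
  have "u = (\<lambda>i. s i - s (Suc i))"
  proof
    fix i
    define z where "z = y * q ^ i"
    define f where "f = x_series q \<mu> 0 z"
    define f' where "f' = x_series q \<mu> 0 (z * q)"
    define m where "m = x_moment z"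
    define m' where "m' = x_moment (z * q)"
    have z: "\<bar>z\<bar> < 1" "\<bar>z * q\<bar> < 1" "0 < 1 - z" "0 < 1 - \<mu> * z" "z * q = y * q ^ Suc i"
      unfolding z_def using y_q_power_Suc[of i] by (simp_all only:)
    have pos: "0 < f" "0 < f'"
      unfolding f_def f'_def z(5) unfolding z_def using y_q_power[of i] y_q_power[of "Suc i"]
      by (auto intro!: x_series_pos simp del: power_Suc)
    have 1: "(1 - z) * f = (1 - \<mu> * z) * f'"
      unfolding f_def f'_def by (rule x_series_rec[OF z(1,2)])
    have 2: "(1 - z) * m - z * f = (1 - \<mu> * z) * m' - \<mu> * z * f'"
      using x_moment_rec[OF z(1,2)] unfolding f_def f'_def m_def m'_def by (simp add: algebra_simps)
    have "m / f - z / (1 - z) = ((1 - z) * m - z * f) / ((1 - z) * f)"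
      using z pos by (simp add: field_simps)
    also have "\<dots> = ((1 - \<mu> * z) * m' - \<mu> * z * f') / ((1 - \<mu> * z) * f')" unfolding 1 2 ..
    also have "\<dots> = m' / f' - \<mu> * z / (1 - \<mu> * z)"
      using z pos by (simp add: field_simps)
    finally have "m / f - m' / f' = z / (1 - z) - \<mu> * z / (1 - \<mu> * z)" by simp
    also have "\<dots> = (1 - \<mu>) * z / ((1 - z) * (1 - \<mu> * z))"
      using z by (simp add: divide_simps) (simp add: algebra_simps)
    finally show "u i = s i - s (Suc i)"
      unfolding u_def s_def f_def f'_def m_def m'_def z(5) unfolding z_def by (simp add: mult.assoc)
  qed
  moreover have "s \<longlonglongrightarrow> 0 / 1"
    unfolding s_def[abs_def]
    by (intro tendsto_divide x_series_y_q_power_limit filterlim_compose[OF x_moment_tendsto_0 filterlim_y_q_power]) simp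
  then have "(\<lambda>i. s i - s (Suc i)) sums (s 0 - 0)" by (intro telescope_sums') simp
  ultimately have "u sums (x_moment y / x_series q \<mu> 0 y)" by (simp add: s_def)
  then show ?thesis unfolding rho_free_def u_def[symmetric] by (rule sums_unique[symmetric])
qed

lemma rho_sums: "(\<lambda>n. real n * P_free q \<mu> y n) sums rho_free q \<mu> y"
proof -
  have "(\<lambda>n. real n * x_weight q \<mu> 0 n * y ^ n / x_series q \<mu> 0 y) sums (x_moment y / x_series q \<mu> 0 y)"
    using y by (intro sums_divide x_moment_sums) auto
  then show ?thesis by (simp add: rho_free_eq P_free_eq x_weight_0 ac_simps)
qed

lemma P_free_sums: "(\<lambda>n. P_free q \<mu> y n) sums 1"
proof -
  have "(\<lambda>n. x_weight q \<mu> 0 n * y ^ n / x_series q \<mu> 0 y) sums (x_series q \<mu> 0 y / x_series q \<mu> 0 y)"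
    using y by (intro sums_divide x_series_sums) auto
  then show ?thesis using x_series_y_pos by (simp add: P_free_eq x_weight_0 ac_simps)
qed

text \<open>The rate for l = i + 1 particles to leave n = m + l, weighted by the probability of n,
  is the probability of m times a function of l alone. The sum over m in the current is then the
  total mass of \<open>P_free\<close>.\<close>

lemma w_minus_P_free:
  "w_minus q \<mu> (Suc i) (m + Suc i) * P_free q \<mu> y (m + Suc i) = y ^ Suc i / (1 - q ^ Suc i) * P_free q \<mu> y m"
proof -
  have nz: "qpoch q q k \<noteq> 0" for k using qpoch_pos[of q k] q by simp
  have "\<mu> * q ^ m \<le> \<mu>" using mu q by (intro mult_left_le) (auto simp: power_le_one)
  then have "\<mu> * q ^ m < 1" using mu by linarith
  then have nz': "qpoch q (\<mu> * q ^ m) (Suc i) \<noteq> 0" using qpoch_pos[of "\<mu> * q ^ m" "Suc i"] by simp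
  have "qpoch q \<mu> (m + Suc i) = qpoch q \<mu> m * qpoch q (\<mu> * q ^ m) (Suc i)"
    by (rule qpoch_add)
  then have "g q \<mu> (m + Suc i) = g q \<mu> m * qpoch q q m * qpoch q (\<mu> * q ^ m) (Suc i) / qpoch q q (m + Suc i)"
    using nz by (simp add: g_def)
  moreover have "qpoch q q (Suc i) = qpoch q q i * (1 - q ^ Suc i)" by (simp add: qpoch_def)
  ultimately show ?thesis
    using nz nz' power_add[of y m "Suc i"]
    by (simp add: w_minus_def qbinom_def P_free_eq del: power_Suc add_Suc_right)
qed

end

text \<open>Expand z q^i / (1 - z q^i)^2 as the sum of the l (z q^i)^l and sum over i first. All
  terms are nonnegative, so the two orders agree.\<close>

lemma has_sum_h:
  assumes q: "0 < q" "q < 1" and z: "0 < z" "z < 1"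
  shows "((\<lambda>l. real (Suc l) * z ^ Suc l / (1 - q ^ Suc l)) has_sum h q z) UNIV"
proof -
  define F where "F = (\<lambda>(i::nat, l::nat). real (Suc l) * (z * q ^ i) ^ Suc l)"
  define H where "H i = z * q ^ i / (1 - z * q ^ i)\<^sup>2" for i
  have zq: "0 < z * q ^ i" "z * q ^ i \<le> z" for i
    using q z by (auto intro!: mult_left_le simp: power_le_one)
  then have zq1: "z * q ^ i < 1" for i using z order_le_less_trans by blast
  have row: "((\<lambda>l. F (i, l)) has_sum H i) UNIV" for i
  proof (rule sums_nonneg_imp_has_sum)
    have "(\<lambda>l. (z * q ^ i) * (of_nat (Suc l) * (z * q ^ i) ^ l)) sums ((z * q ^ i) * (1 / (1 - z * q ^ i)\<^sup>2))"
      using zq[of i] zq1[of i] by (intro sums_mult geometric_deriv_sums) (simp add: abs_of_pos)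
    then show "(\<lambda>l. F (i, l)) sums H i" by (simp add: F_def H_def ac_simps)
  qed (use q z in \<open>simp add: F_def\<close>)
  have H0: "0 \<le> H i" for i
    unfolding H_def using zq(1)[of i] by (intro divide_nonneg_nonneg) auto
  have "summable H"
  proof (rule summable_comparison_test'[of "\<lambda>i. z / (1 - z)\<^sup>2 * q ^ i" 0])
    show "summable (\<lambda>i. z / (1 - z)\<^sup>2 * q ^ i)" using q by (intro summable_mult summable_geometric) auto
    fix i
    have "z * q ^ i / (1 - z * q ^ i)\<^sup>2 \<le> z * q ^ i / (1 - z)\<^sup>2"
      using zq[of i] zq1[of i] z q by (intro divide_left_mono power_mono mult_pos_pos) auto
    then show "norm (H i) \<le> z / (1 - z)\<^sup>2 * q ^ i" using zq[of i] by (simp add: H_def abs_of_pos)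
  qed
  then have H: "(H has_sum h q z) UNIV"
    unfolding h_def H_def[symmetric]
    by (intro sums_nonneg_imp_has_sum summable_sums H0)
  have "F summable_on UNIV \<times> UNIV"
    by (rule summable_on_SigmaI[OF row]) (use H q z in \<open>auto simp: summable_on_def F_def\<close>)
  then have "(F has_sum h q z) (UNIV \<times> UNIV)"
    by (rule has_sum_SigmaI[OF row H])
  then have "((\<lambda>(l, i). F (i, l)) has_sum h q z) (UNIV \<times> UNIV)"
    by (subst (asm) has_sum_swap)
  then show ?thesis
  proof (rule has_sum_SigmaD)
    fix l
    have "0 < q ^ Suc l" "q ^ Suc l < 1" using q power_less_one_iff[of q "Suc l"] by (auto simp del: power_Suc)
    then have "(\<lambda>i. real (Suc l) * z ^ Suc l * (q ^ Suc l) ^ i) sums (real (Suc l) * z ^ Suc l * (1 / (1 - q ^ Suc l)))"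
      by (intro sums_mult geometric_sums) (simp del: power_Suc)
    moreover have "real (Suc l) * z ^ Suc l * (q ^ Suc l) ^ i = F (i, l)" for i
      by (simp add: F_def power_mult_distrib mult.commute flip: power_mult del: power_Suc)
    ultimately have "(\<lambda>i. F (i, l)) sums (real (Suc l) * z ^ Suc l / (1 - q ^ Suc l))" by simp
    then show "((\<lambda>i. case (l, i) of (l, i) \<Rightarrow> F (i, l)) has_sum real (Suc l) * z ^ Suc l / (1 - q ^ Suc l)) UNIV"
      unfolding prod.case by (rule sums_nonneg_imp_has_sum) (use q z in \<open>simp add: F_def\<close>)
  qed
qed

text \<open>\<beta> = 1 gives \<open>w_minus\<close> and \<beta> = \<mu> gives
  \<open>w_plus\<close>. The factor \<beta>^(l - 1) turns y^l into (\<beta> y)^l / \<beta>, the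
  origin of the 1/\<mu> in J_+.\<close>

lemma (in q_params) has_sum_current:
  assumes \<beta>: "0 < \<beta>" "\<beta> \<le> 1"
    and w: "\<And>i n. w (Suc i) n = \<beta> ^ i * w_minus q \<mu> (Suc i) n"
  shows "((\<lambda>(n, l). real l * w l n * P_free q \<mu> y n) has_sum h q (\<beta> * y) / \<beta>) J_dom"
proof -
  define F where "F = (\<lambda>(i, m). real (Suc i) * (\<beta> * y) ^ Suc i / (1 - q ^ Suc i) / \<beta> * P_free q \<mu> y m)"
  define c where "c i = real (Suc i) * (\<beta> * y) ^ Suc i / (1 - q ^ Suc i) / \<beta>" for i
  have q1: "0 < 1 - q ^ Suc i" for i using q power_less_one_iff[of q "Suc i"] by (auto simp del: power_Suc)
  have c0: "0 \<le> c i" for i using q1[of i] \<beta> y by (simp add: c_def del: power_Suc)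
  have P0: "0 \<le> P_free q \<mu> y n" for n
    using y g_pos[of n] x_series_y_pos by (simp add: P_free_eq)
  have F0: "0 \<le> F (i, n)" for i n
    using mult_nonneg_nonneg[OF c0 P0] unfolding F_def c_def by simp
  have "\<beta> * y < 1" using mult_left_le_one_le[of y \<beta>] \<beta> y by linarith
  then have C: "(c has_sum h q (\<beta> * y) / \<beta>) UNIV"
    unfolding c_def using has_sum_h[OF q, of "\<beta> * y"] \<beta> y
    by (simp add: divide_inverse has_sum_cmult_left del: power_Suc)
  have row: "((\<lambda>m. F (i, m)) has_sum c i) UNIV" for i
  proof (rule sums_nonneg_imp_has_sum)
    show "(\<lambda>m. F (i, m)) sums c i"
      using sums_mult[OF P_free_sums, of "c i"] by (simp add: F_def c_def)
    show "0 \<le> F (i, n)" for n by (rule F0)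
  qed
  have "F summable_on UNIV \<times> UNIV"
    by (rule summable_on_SigmaI[OF row])
      (use C F0 in \<open>auto simp: summable_on_def\<close>)
  then have "(F has_sum h q (\<beta> * y) / \<beta>) (UNIV \<times> UNIV)"
    by (rule has_sum_SigmaI[OF row C])
  also have "?this \<longleftrightarrow> ((\<lambda>(n, l). real l * w l n * P_free q \<mu> y n) has_sum h q (\<beta> * y) / \<beta>) J_dom"
  \<comment> \<open>Here l = i + 1 counts the particles that jump and m = n - l those that
    stay.\<close>
  proof (rule has_sum_reindex_bij_witness[where j = "\<lambda>(i, m). (m + Suc i, Suc i)" and i = "\<lambda>(n, l). (l - 1, n - l)"])
    fix x :: "nat \<times> nat"
    obtain i m where x: "x = (i, m)" by (cases x)
    have "real (Suc i) * w (Suc i) (m + Suc i) * P_free q \<mu> y (m + Suc i) =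
      real (Suc i) * \<beta> ^ i * (w_minus q \<mu> (Suc i) (m + Suc i) * P_free q \<mu> y (m + Suc i))"
      by (simp only: w ac_simps)
    also have "\<dots> = F (i, m)"
      unfolding w_minus_P_free F_def using \<beta> by (simp add: power_mult_distrib)
    finally show "(case case x of (i, m) \<Rightarrow> (m + Suc i, Suc i) of (n, l) \<Rightarrow> real l * w l n * P_free q \<mu> y n) = F x"
      by (simp add: x)
  qed (auto simp: J_dom_def)
  finally show ?thesis .
qed

theorem theorem9:
  fixes q \<mu> y :: real and ds :: "nat list" and r :: int
  assumes "0 < q" "q < 1" "0 < \<mu>" "\<mu> < 1" "0 < y" "y < 1"
    and "length ds \<ge> 1" "hd ds \<ge> 1" "last ds \<ge> 1"
    and "r \<le> 0"
  shows "(\<forall>n. (\<forall>L > nat \<bar>r\<bar> + length ds.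
              summable (Tr_series q \<mu> y [(0, n)] (num_sites ds r L)) \<and>
              summable (Tr_series q \<mu> y [] (den_sites ds L))) \<and>
            convergent (P_ring q \<mu> y ds r n) \<and>
            P_III q \<mu> y ds r n = complex_of_real (P_free q \<mu> y n)) \<and>
         summable (rho_term q \<mu> y ds r) \<and>
         rho_III q \<mu> y ds r = complex_of_real (rho_free q \<mu> y) \<and>
         J_term (w_plus q \<mu>) q \<mu> y ds r summable_on J_dom \<and>
         J_III_plus q \<mu> y ds r = complex_of_real (J_free_plus q \<mu> y) \<and>
         J_term (w_minus q \<mu>) q \<mu> y ds r summable_on J_dom \<and>
         J_III_minus q \<mu> y ds r = complex_of_real (J_free_minus q y)"
proof -
  interpret q_params q \<mu> y by unfold_locales (use assms in auto)
  have ds: "1 \<le> sum_list ds" using assms(7,8) by (cases ds) auto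
  note lim = P_ring_tendsto[OF ds, of r, folded P_free_eq]
  have P: "P_III q \<mu> y ds r n = of_real (P_free q \<mu> y n)" for n
    unfolding P_III_def by (rule limI[OF lim])
  have "rho_term q \<mu> y ds r sums of_real (rho_free q \<mu> y)"
    using sums_of_real[OF rho_sums] by (simp add: rho_term_def[abs_def] P)
  then have rho: "summable (rho_term q \<mu> y ds r)" "rho_III q \<mu> y ds r = of_real (rho_free q \<mu> y)"
    unfolding rho_III_def by (auto simp: sums_iff)
  have J: "(J_term w q \<mu> y ds r has_sum of_real (h q (\<beta> * y) / \<beta>)) J_dom"
    if "0 < \<beta>" "\<beta> \<le> 1" "\<And>i n. w (Suc i) n = \<beta> ^ i * w_minus q \<mu> (Suc i) n" for w \<beta>
    using has_sum_of_real[OF has_sum_current[OF that], where 'a = complex]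
    by (simp add: J_term_def P case_prod_unfold)
  have "(J_term (w_plus q \<mu>) q \<mu> y ds r has_sum of_real (J_free_plus q \<mu> y)) J_dom"
    unfolding J_free_plus_def by (rule J) (use mu in \<open>auto simp: w_plus_def w_minus_def\<close>)
  moreover have "(J_term (w_minus q \<mu>) q \<mu> y ds r has_sum of_real (J_free_minus q y)) J_dom"
    using J[of 1 "w_minus q \<mu>"] by (simp add: J_free_minus_def)
  ultimately show ?thesis
    using rho lim P summable_num[OF ds] summable_den[OF ds]
    unfolding J_III_plus_def J_III_minus_def
    by (auto simp: has_sum_iff convergent_def)
qed

end
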